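(* Let $T>0$ and suppose that $\eta_0\in C^3[0,1]$ with $\eta_0(0)=\eta_0'(0)=\eta_0''(0)=0$. Let $\eta$ be the solution of \[ \eta_t+\eta_x=0\ \ (0\le x\le1,\ 0\le t\le T),\qquad \eta(x,0)=\eta_0(x)\ \ (0\le x\le1),\qquad \eta(0,t)=0\ \ (0\le t\le T), \] and let $\eta_h:[0,T]\to\mathring S_h^2$ be the solution of the semidiscrete problem \[ (\eta_{ht},\phi)+(\eta_{hx},\phi)=0\quad\forall\phi\in\mathring S_h^2,\ 0\le t\le T,\qquad \eta_h(0)=P\eta_0 . \] Then there is a constant $C(T)$ independent of $h$ such that \[ \max_{0\le t\le T}\|\eta(t)-\eta_h(t)\|\le C(T)\,h^2\max_{0\le t\le T}\|\eta\|_{3,\infty}. \]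
   Context: For an integer $N\ge2$, $h=1/N$, $x_i=ih$, $i=0,1,\dots,N$, $I_j=[x_{j-1},x_j]$; $\mathring S_h^2=\{\phi\in C[0,1]:\phi|_{I_j}\in\mathbb P_1,\ 1\le j\le N,\ \phi(0)=0\}$ ($\mathbb P_1$: polynomials of degree $\le1$). $(\cdot,\cdot)$, $\|\cdot\|$ are the inner product and norm of $L^2(0,1)$; $P$ is the $L^2$-projection onto $\mathring S_h^2$; $\|\cdot\|_{3,\infty}$ is the norm of $W^3_\infty(0,1)$ (in the variable $x$). The solution is $\eta(x,t)=\eta_0(x-t)$ for $x>t$ and $\eta(x,t)=0$ for $x<t$; for each $t$ it is $C^2$ and piecewise $C^3$ in $x$. *)

theory Defs
  imports "HOL-Analysis.Analysis" "HOL-Probability.Essential_Supremum"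
begin

text \<open>The derivative of a function on a set, one-sided at the end points of an interval.
  It is an unspecified value at points where the function is not differentiable.\<close>

definition derivative_on :: "real set \<Rightarrow> (real \<Rightarrow> real) \<Rightarrow> real \<Rightarrow> real" where
  "derivative_on S f x = vector_derivative f (at x within S)"

definition C_k_on :: "nat \<Rightarrow> real set \<Rightarrow> (real \<Rightarrow> real) \<Rightarrow> bool" where
  "C_k_on k S f \<longleftrightarrow>
     (\<forall>j<k. (derivative_on S ^^ j) f differentiable_on S) \<and>
     (\<forall>j\<le>k. continuous_on S ((derivative_on S ^^ j) f))"

definition L2_inner :: "(real \<Rightarrow> real) \<Rightarrow> (real \<Rightarrow> real) \<Rightarrow> real" where
  "L2_inner f g = (LINT x:{0..1}|lebesgue. f x * g x)"

definition L2_norm :: "(real \<Rightarrow> real) \<Rightarrow> real" where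
  "L2_norm f = sqrt (L2_inner f f)"

definition test_function :: "(real \<Rightarrow> real) \<Rightarrow> bool" where
  "test_function \<phi> \<longleftrightarrow>
     (\<forall>k. (deriv ^^ k) \<phi> differentiable_on UNIV) \<and>
     (\<exists>a b. 0 < a \<and> a \<le> b \<and> b < 1 \<and> (\<forall>x. x \<notin> {a..b} \<longrightarrow> \<phi> x = 0))"

definition locally_integrable :: "(real \<Rightarrow> real) \<Rightarrow> bool" where
  "locally_integrable f \<longleftrightarrow>
     (\<forall>a b. 0 < a \<longrightarrow> a \<le> b \<longrightarrow> b < 1 \<longrightarrow> set_integrable lebesgue {a..b} f)"

definition has_weak_derivative :: "nat \<Rightarrow> (real \<Rightarrow> real) \<Rightarrow> (real \<Rightarrow> real) \<Rightarrow> bool" where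
  "has_weak_derivative k f g \<longleftrightarrow>
     locally_integrable f \<and> locally_integrable g \<and>
     (\<forall>\<phi>. test_function \<phi> \<longrightarrow>
        L2_inner f ((deriv ^^ k) \<phi>) = (-1) ^ k * L2_inner g \<phi>)"

text \<open>Weak derivatives are unique up to null sets, so the choice below does not affect the
  norms built from it.\<close>

definition weak_derivative :: "nat \<Rightarrow> (real \<Rightarrow> real) \<Rightarrow> real \<Rightarrow> real" where
  "weak_derivative k f = (SOME g. has_weak_derivative k f g)"

text \<open>The real value is meaningful for essentially bounded functions only.\<close>

definition Linf_norm :: "(real \<Rightarrow> real) \<Rightarrow> real" where
  "Linf_norm f = real_of_ereal (esssup (restrict_space lebesgue {0<..<1}) (\<lambda>x. ereal \<bar>f x\<bar>))"

text \<open>The norm of \<open>W\<^sup>m\<^sub>\<infinity>(0,1)\<close>, with the maximum (rather than the sum) over the orders of derivatives.\<close>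

definition Winf_norm :: "nat \<Rightarrow> (real \<Rightarrow> real) \<Rightarrow> real" where
  "Winf_norm m f = Max ((\<lambda>k. Linf_norm (weak_derivative k f)) ` {..m})"

text \<open>Only the values on \<open>[0,1]\<close> of the members of the following space matter.\<close>

definition S_h :: "nat \<Rightarrow> (real \<Rightarrow> real) set" where
  "S_h N = {\<phi>. continuous_on {0..1} \<phi> \<and>
      (\<forall>j\<in>{1..N}. \<exists>p :: real poly. degree p \<le> 1 \<and>
          (\<forall>x\<in>{(real j - 1) / real N .. real j / real N}. \<phi> x = poly p x)) \<and>
      \<phi> 0 = 0}"

definition is_L2_projection :: "nat \<Rightarrow> (real \<Rightarrow> real) \<Rightarrow> (real \<Rightarrow> real) \<Rightarrow> bool" where
  "is_L2_projection N f p \<longleftrightarrow>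
     p \<in> S_h N \<and> (\<forall>\<phi>\<in>S_h N. L2_inner (\<lambda>x. f x - p x) \<phi> = 0)"

text \<open>Classical (that is, \<open>C\<^sup>1\<close>) solutions on the closed space-time rectangle;
  \<open>\<eta> t x\<close> is the value at time \<open>t\<close> and position \<open>x\<close>.\<close>

definition transport_solution :: "real \<Rightarrow> (real \<Rightarrow> real) \<Rightarrow> (real \<Rightarrow> real \<Rightarrow> real) \<Rightarrow> bool" where
  "transport_solution T \<eta>\<^sub>0 \<eta> \<longleftrightarrow>
     (\<forall>t\<in>{0..T}. \<eta> t differentiable_on {0..1}) \<and>
     (\<forall>x\<in>{0..1}. (\<lambda>s. \<eta> s x) differentiable_on {0..T}) \<and>
     continuous_on ({0..T} \<times> {0..1}) (\<lambda>(t, x). \<eta> t x) \<and>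
     continuous_on ({0..T} \<times> {0..1}) (\<lambda>(t, x). derivative_on {0..T} (\<lambda>s. \<eta> s x) t) \<and>
     continuous_on ({0..T} \<times> {0..1}) (\<lambda>(t, x). derivative_on {0..1} (\<eta> t) x) \<and>
     (\<forall>t\<in>{0..T}. \<forall>x\<in>{0..1}.
        derivative_on {0..T} (\<lambda>s. \<eta> s x) t + derivative_on {0..1} (\<eta> t) x = 0) \<and>
     (\<forall>x\<in>{0..1}. \<eta> 0 x = \<eta>\<^sub>0 x) \<and>
     (\<forall>t\<in>{0..T}. \<eta> t 0 = 0)"

text \<open>Since the space is finite-dimensional, differentiability in time is the same as
  differentiability of \<open>s \<mapsto> \<eta>\<^sub>h s x\<close> for every \<open>x\<close>. The spatial derivative is piecewise constant;
  its unspecified values at the nodes do not affect the integral.\<close>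

definition semidiscrete_solution ::
    "nat \<Rightarrow> real \<Rightarrow> (real \<Rightarrow> real) \<Rightarrow> (real \<Rightarrow> real \<Rightarrow> real) \<Rightarrow> bool" where
  "semidiscrete_solution N T \<eta>\<^sub>0 \<eta>\<^sub>h \<longleftrightarrow>
     (\<forall>t\<in>{0..T}. \<eta>\<^sub>h t \<in> S_h N) \<and>
     (\<forall>x\<in>{0..1}. (\<lambda>s. \<eta>\<^sub>h s x) differentiable_on {0..T}) \<and>
     (\<forall>t\<in>{0..T}. \<forall>\<phi>\<in>S_h N.
        L2_inner (\<lambda>x. derivative_on {0..T} (\<lambda>s. \<eta>\<^sub>h s x) t) \<phi>
        + L2_inner (derivative_on {0..1} (\<eta>\<^sub>h t)) \<phi> = 0) \<and>
     is_L2_projection N \<eta>\<^sub>0 (\<eta>\<^sub>h 0)"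

end

theory Submission
  imports Defs
begin

text \<open>
  Write \<open>h = 1 / N\<close>. The solution of the transport problem is \<open>w (x - t)\<close>, where \<open>w\<close> extends the
  initial value by zero to the left. As \<open>\<eta>\<^sub>0\<close> and its first two derivatives vanish at \<open>0\<close>, the
  extension is twice continuously differentiable, and its second derivative has as Lipschitz constant
  the maximum \<open>K\<close> of the absolute value of the third derivative of \<open>\<eta>\<^sub>0\<close>. Since \<open>w\<close> vanishes on the
  negative axis, \<open>K\<close> also bounds \<open>w\<close> and its first two derivatives to the left of \<open>1\<close>.

  The semidiscrete solution is compared with the piecewise linear interpolant of the exact one. The
  interpolation error is pointwise of order \<open>K h\<^sup>2\<close>, so everything depends on the nodal errors
  \<open>e j\<close>. Let \<open>E\<close> be the squared \<open>L\<^sup>2\<close> norm of the piecewise linear function with these nodal values.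
  Testing the scheme with this function (\<open>semidiscrete_solution_nodal_equation\<close>) shows that \<open>E\<close> has
  the time derivative \<open>- (e N)\<^sup>2\<close>, up to twice the defect that the nodal values of the exact solution
  leave in the scheme. On a uniform mesh the row of the scheme at an interior node compares half
  the integral of \<open>w'\<close> over the two neighbouring cells with half its approximation by Simpson's rule.
  Its defect is therefore of
  order \<open>K h\<^sup>3\<close>, although each of the two cells contributes a term of order \<open>K h\<^sup>2\<close>: the contributions
  cancel. At the outflow node there is no second cell and the defect is of order \<open>K h\<^sup>2\<close>, but there
  it is multiplied by \<open>e N\<close> and the outflow term \<open>- (e N)\<^sup>2\<close> absorbs it. Together
  (\<open>consistency\<close>, \<open>energy_rate_bound\<close>) this gives \<open>E' \<le> 5 K\<^sup>2 h\<^sup>4 + 6 E\<close>. The \<open>L\<^sup>2\<close> projection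
  starts \<open>E\<close> at order \<open>K\<^sup>2 h\<^sup>4\<close>, and Gronwall's inequality keeps it there.

  It remains to compare \<open>K\<close> with the norm on the right-hand side, which is made of essential suprema
  of arbitrarily chosen weak derivatives. Two weak derivatives agree almost everywhere
  (\<open>has_weak_derivative_unique\<close>); this rests on smooth functions with compact support that
  approximate the indicator of an interval. As the weak derivatives of the solution are the
  translates of those of \<open>w\<close>, its norm is at most \<open>K\<close> at every time and at least \<open>K\<close> at time \<open>0\<close>.
  The first bound is what makes the supremum over time meaningful, the second one bounds \<open>K\<close> by it.
\<close>

section \<open>Smooth test functions\<close>

text \<open>With \<open>w = (x - a) * (b - x)\<close> the derivative of \<open>p / w ^ k * exp (- c / w)\<close> has the same form, with
  another polynomial and a larger power. Keeping \<open>p\<close> and \<open>k\<close> as parameters thus makes the family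
  closed under differentiation. The parameter \<open>c\<close> controls the steepness: as it tends to \<open>0\<close>, the
  function with \<open>p = 1\<close> and \<open>k = 0\<close> tends to the indicator of the open interval.\<close>

definition exp_bump :: "real poly \<Rightarrow> nat \<Rightarrow> real \<Rightarrow> real \<Rightarrow> real \<Rightarrow> real \<Rightarrow> real" where
  "exp_bump p k c a b x =
     (if a < x \<and> x < b
      then poly p x / ((x - a) * (b - x)) ^ k * exp (- (c / ((x - a) * (b - x)))) else 0)"

text \<open>A single term of the exponential series, the one of order \<open>k + 2\<close>, already beats the pole and
  leaves two powers of \<open>w\<close>, which is what makes the bump differentiable where it is glued to zero.\<close>

lemma exp_inverse_le_power:
  fixes w c :: real
  assumes "0 < w" "0 < c"
  shows "exp (- (c / w)) / w ^ k \<le> fact (k + 2) / c ^ (k + 2) * w\<^sup>2"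
proof -
  have "(c / w) ^ (k + 2) / fact (k + 2) \<le> (\<Sum>n<k + 3. (c / w) ^ n / fact n)"
    using assms by (intro member_le_sum) auto
  also have "\<dots> \<le> exp (c / w)"
  proof -
    have "(\<Sum>n<k + 3. (c / w) ^ n /\<^sub>R fact n) \<le> exp (c / w)"
      unfolding exp_def using assms summable_exp_generic[of "c / w"]
      by (intro sum_le_suminf) auto
    then show ?thesis by (simp add: divide_inverse mult.commute)
  qed
  finally have *: "(c / w) ^ (k + 2) / fact (k + 2) \<le> exp (c / w)" .
  define F :: real where "F = fact (k + 2)"
  define D where "D = c ^ (k + 2)"
  have pos: "0 < F" "0 < D" using assms by (simp_all add: F_def D_def)
  from * have "D / w ^ (k + 2) / F \<le> exp (c / w)"
    by (simp only: power_divide F_def D_def)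
  then have "D \<le> F * (exp (c / w) * w ^ (k + 2))"
    using assms(1) pos by (simp add: pos_divide_le_eq mult_ac)
  then have "1 \<le> F / D * w\<^sup>2 * (exp (c / w) * w ^ k)"
    using pos assms(1) by (simp add: pos_le_divide_eq power_add mult_ac power2_eq_square)
  then have "exp (- (c / w)) / w ^ k \<le> F / D * w\<^sup>2"
    using assms(1) pos by (simp add: exp_minus field_simps)
  then show ?thesis by (simp only: F_def D_def)
qed

lemma DERIV_0_quadratic_bound:
  fixes f :: "real \<Rightarrow> real"
  assumes "\<And>x. \<bar>f x\<bar> \<le> C * (x - z)\<^sup>2"
  shows "DERIV f z :> 0"
proof -
  have f0: "f z = 0" using assms[of z] by simp
  have "((\<lambda>x. (f x - f z) / (x - z)) \<longlongrightarrow> 0) (at z)"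
  proof (rule Lim_null_comparison)
    show "\<forall>\<^sub>F x in at z. norm ((f x - f z) / (x - z)) \<le> C * \<bar>x - z\<bar>"
    proof (rule eventually_at_filter[THEN iffD2], rule always_eventually, safe)
      fix x :: real assume "x \<noteq> z"
      then have "\<bar>f x\<bar> \<le> C * \<bar>x - z\<bar> * \<bar>x - z\<bar>"
        using assms[of x] by (simp add: power2_eq_square abs_mult_self_eq mult.assoc)
      then show "norm ((f x - f z) / (x - z)) \<le> C * \<bar>x - z\<bar>"
        using \<open>x \<noteq> z\<close> f0 by (simp add: abs_divide divide_le_eq)
    qed
    show "((\<lambda>x. C * \<bar>x - z\<bar>) \<longlongrightarrow> 0) (at z)"
      by (auto intro!: tendsto_eq_intros)
  qed
  then show ?thesis by (simp add: has_field_derivative_iff)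
qed

lemma exp_bump_quadratic_bound:
  assumes "a < b" "0 < c"
  obtains C where "\<And>x. \<bar>exp_bump p k c a b x\<bar> \<le> C * (x - a)\<^sup>2"
    "\<And>x. \<bar>exp_bump p k c a b x\<bar> \<le> C * (x - b)\<^sup>2"
proof -
  have "bounded (poly p ` {a..b})"
    by (intro compact_imp_bounded compact_continuous_image continuous_intros) auto
  then obtain B where B: "\<And>x. x \<in> {a..b} \<Longrightarrow> \<bar>poly p x\<bar> \<le> B" "0 < B"
    unfolding bounded_pos by (metis imageI real_norm_def)
  define A where "A = fact (k + 2) / c ^ (k + 2)"
  have A: "0 < A" using assms by (simp add: A_def)
  have main: "\<bar>exp_bump p k c a b x\<bar> \<le> B * (A * ((x - a) * (b - x))\<^sup>2)" if "a < x" "x < b" for x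
  proof -
    have "0 < (x - a) * (b - x)" using that by simp
    from exp_inverse_le_power[OF this assms(2)]
    have "exp (- (c / ((x - a) * (b - x)))) / ((x - a) * (b - x)) ^ k \<le> A * ((x - a) * (b - x))\<^sup>2"
      by (simp add: A_def)
    then have "\<bar>poly p x\<bar> * (exp (- (c / ((x - a) * (b - x)))) / ((x - a) * (b - x)) ^ k)
        \<le> B * (A * ((x - a) * (b - x))\<^sup>2)"
      using B that by (intro mult_mono) auto
    then show ?thesis using that by (simp add: exp_bump_def abs_mult abs_divide)
  qed
  have "\<bar>exp_bump p k c a b x\<bar> \<le> (B * A * (b - a)\<^sup>2) * (x - a)\<^sup>2" for x
  proof (cases "a < x \<and> x < b")
    case True
    have "(b - x)\<^sup>2 \<le> (b - a)\<^sup>2" using True by (intro power_mono) auto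
    then have "B * A * (x - a)\<^sup>2 * (b - x)\<^sup>2 \<le> B * A * (x - a)\<^sup>2 * (b - a)\<^sup>2"
      using A B by (intro mult_left_mono) auto
    then show ?thesis using main[of x] True by (simp add: power_mult_distrib mult_ac)
  next
    case False
    then show ?thesis using A B by (auto simp: exp_bump_def)
  qed
  moreover have "\<bar>exp_bump p k c a b x\<bar> \<le> (B * A * (b - a)\<^sup>2) * (x - b)\<^sup>2" for x
  proof (cases "a < x \<and> x < b")
    case True
    have "(x - a)\<^sup>2 \<le> (b - a)\<^sup>2" using True by (intro power_mono) auto
    then have "B * A * (b - x)\<^sup>2 * (x - a)\<^sup>2 \<le> B * A * (b - x)\<^sup>2 * (b - a)\<^sup>2"
      using A B by (intro mult_left_mono) auto
    then show ?thesis using main[of x] True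
      by (simp add: power_mult_distrib mult_ac power2_commute[of x b])
  next
    case False
    then show ?thesis using A B by (auto simp: exp_bump_def)
  qed
  ultimately show thesis by (rule that)
qed

text \<open>In the open interval this is the quotient rule; at the two end points the quadratic bound gives
  the derivative \<open>0\<close>.\<close>

lemma exp_bump_deriv:
  assumes "a < b" "0 < c"
  shows "\<exists>q l. \<forall>x. DERIV (exp_bump p k c a b) x :> exp_bump q l c a b x"
proof -
  define W where "W = [:-a, 1:] * [:b, -1:]"
  define q where "q = pderiv p * W\<^sup>2 - smult (real k) (p * pderiv W * W) + smult c (p * pderiv W)"
  have W: "poly W x = (x - a) * (b - x)" for x by (simp add: W_def algebra_simps)
  have "DERIV (exp_bump p k c a b) x :> exp_bump q (k + 2) c a b x" for x
  proof -
    obtain C where C: "\<And>x. \<bar>exp_bump p k c a b x\<bar> \<le> C * (x - a)\<^sup>2"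
      "\<And>x. \<bar>exp_bump p k c a b x\<bar> \<le> C * (x - b)\<^sup>2"
      using exp_bump_quadratic_bound[OF assms] by metis
    consider "x = a" | "x = b" | "x < a" | "x > b" | "a < x" "x < b" by linarith
    then show ?thesis
    proof cases
      case 1 then show ?thesis using DERIV_0_quadratic_bound[of "exp_bump p k c a b", OF C(1)] by (simp add: exp_bump_def[of q])
    next
      case 2 then show ?thesis using DERIV_0_quadratic_bound[of "exp_bump p k c a b", OF C(2)] by (simp add: exp_bump_def[of q])
    next
      case 3
      have "DERIV (\<lambda>_. 0 :: real) x :> 0" by simp
      then have "DERIV (exp_bump p k c a b) x :> 0"
        by (rule has_field_derivative_transform_within_open[of _ _ _ "{..<a}"])
          (use 3 in \<open>auto simp: exp_bump_def\<close>)
      then show ?thesis using 3 by (simp add: exp_bump_def)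
    next
      case 4
      have "DERIV (\<lambda>_. 0 :: real) x :> 0" by simp
      then have "DERIV (exp_bump p k c a b) x :> 0"
        by (rule has_field_derivative_transform_within_open[of _ _ _ "{b<..}"])
          (use 4 in \<open>auto simp: exp_bump_def\<close>)
      then show ?thesis using 4 by (simp add: exp_bump_def)
    next
      case 5
      define w where "w = poly W x"
      define w' where "w' = poly (pderiv W) x"
      have w: "w > 0" using 5 by (simp add: w_def W)
      have "DERIV (\<lambda>x. poly p x / poly W x ^ k * exp (- (c / poly W x))) x :>
        (poly (pderiv p) x * w ^ k - poly p x * (real k * w ^ (k - 1) * w')) / (w ^ k * w ^ k) * exp (- (c / w))
         + poly p x / w ^ k * (exp (- (c / w)) * (c * w' / (w * w)))"
        using w unfolding w_def w'_def
        by (auto intro!: derivative_eq_intros simp: field_simps)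
      also have "(poly (pderiv p) x * w ^ k - poly p x * (real k * w ^ (k - 1) * w')) / (w ^ k * w ^ k) * exp (- (c / w))
         + poly p x / w ^ k * (exp (- (c / w)) * (c * w' / (w * w))) = poly q x / w ^ (k + 2) * exp (- (c / w))"
        using w by (cases k) (simp_all add: q_def w_def[symmetric] w'_def[symmetric] field_simps power2_eq_square)
      finally have "DERIV (exp_bump p k c a b) x :> poly q x / w ^ (k + 2) * exp (- (c / w))"
        by (rule has_field_derivative_transform_within_open[of _ _ _ "{a<..<b}"])
          (use 5 in \<open>auto simp: exp_bump_def W\<close>)
      then show ?thesis using 5 by (simp add: exp_bump_def w_def W)
    qed
  qed
  then show ?thesis by blast
qed

lemma test_function_exp_bump:
  assumes "0 < a" "a < b" "b < 1" "0 < c"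
  shows "test_function (exp_bump p k c a b)"
proof -
  have "\<exists>q l. (deriv ^^ n) (exp_bump p k c a b) = exp_bump q l c a b" for n
  proof (induction n)
    case 0 then show ?case by auto
  next
    case (Suc n)
    then obtain q l where ql: "(deriv ^^ n) (exp_bump p k c a b) = exp_bump q l c a b" by blast
    obtain q' l' where "\<forall>x. DERIV (exp_bump q l c a b) x :> exp_bump q' l' c a b x"
      using exp_bump_deriv[OF assms(2,4)] by blast
    then have "deriv (exp_bump q l c a b) = exp_bump q' l' c a b"
      by (auto simp: fun_eq_iff intro!: DERIV_imp_deriv)
    then show ?case using ql by auto
  qed
  moreover have "exp_bump q l c a b differentiable_on UNIV" for q l
    using exp_bump_deriv[OF assms(2,4), of q l]
    by (auto simp: differentiable_on_def real_differentiable_def)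
  ultimately have "(deriv ^^ n) (exp_bump p k c a b) differentiable_on UNIV" for n by metis
  moreover have "\<forall>x. x \<notin> {a..b} \<longrightarrow> exp_bump p k c a b x = 0"
    by (auto simp: exp_bump_def)
  ultimately show ?thesis
    unfolding test_function_def using assms by (blast intro: less_imp_le)
qed

section \<open>The fundamental lemma of the calculus of variations\<close>

text \<open>Dominated convergence: the bumps lie between \<open>0\<close> and \<open>1\<close> and tend to \<open>1\<close> inside the interval as
  the parameter \<open>1 / Suc n\<close> tends to \<open>0\<close>.\<close>

lemma L2_inner_bump_tendsto:
  assumes ab: "0 < a" "a < b" "b < 1" and g: "set_integrable lebesgue {a..b} g"
  shows "(\<lambda>n. L2_inner g (exp_bump 1 0 (1 / real (Suc n)) a b)) \<longlonglongrightarrow> (LINT x:{a..b}|lebesgue. g x)"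
proof -
  define \<phi> where "\<phi> n = exp_bump 1 0 (1 / real (Suc n)) a b" for n
  define G where "G x = indicator {a..b} x * g x" for x
  have G: "integrable lebesgue G" using g by (simp add: G_def[abs_def] set_integrable_def)
  have \<phi>_meas: "\<phi> n \<in> borel_measurable borel" for n
  proof -
    have "\<phi> n differentiable_on UNIV"
      using exp_bump_deriv[OF ab(2), of "1 / real (Suc n)" 1 0]
      by (auto simp: differentiable_on_def real_differentiable_def \<phi>_def)
    then show ?thesis
      by (intro borel_measurable_continuous_onI differentiable_imp_continuous_on)
  qed
  have "(\<lambda>n. \<integral>x. G x * \<phi> n x \<partial>lebesgue) \<longlonglongrightarrow> (\<integral>x. G x \<partial>lebesgue)"
  proof (rule integral_dominated_convergence[where w = "\<lambda>x. \<bar>G x\<bar>"])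
    show "G \<in> borel_measurable lebesgue" using G by simp
    show "(\<lambda>x. G x * \<phi> n x) \<in> borel_measurable lebesgue" for n
      using G measurable_completion[of "\<phi> n" lborel borel] \<phi>_meas[of n]
      by (intro borel_measurable_times) auto
    show "integrable lebesgue (\<lambda>x. \<bar>G x\<bar>)" using G by simp
    show "AE x in lebesgue. norm (G x * \<phi> n x) \<le> \<bar>G x\<bar>" for n
      by (rule AE_I2) (auto simp: \<phi>_def exp_bump_def abs_mult intro!: mult_left_le)
    have "{a, b} \<in> null_sets lebesgue" by auto
    then have "AE x in lebesgue. x \<notin> {a, b}" by (rule AE_not_in)
    then show "AE x in lebesgue. (\<lambda>n. G x * \<phi> n x) \<longlonglongrightarrow> G x"
    proof (eventually_elim)
      fix x assume x: "x \<notin> {a, b}"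
      show "(\<lambda>n. G x * \<phi> n x) \<longlonglongrightarrow> G x"
      proof (cases "a < x \<and> x < b")
        case True
        have "(\<lambda>n. (1 / real (Suc n)) * (1 / ((x - a) * (b - x)))) \<longlonglongrightarrow> 0 * (1 / ((x - a) * (b - x)))"
          by (intro tendsto_mult tendsto_const LIMSEQ_Suc[OF lim_1_over_n])
        then have "(\<lambda>n. G x * exp (- ((1 / real (Suc n)) * (1 / ((x - a) * (b - x)))))) \<longlonglongrightarrow> G x * exp (- 0)"
          by (intro tendsto_intros) simp
        then show ?thesis using True by (simp add: \<phi>_def exp_bump_def)
      next
        case False
        then show ?thesis using x by (auto simp: G_def indicator_def)
      qed
    qed
  qed
  moreover have "L2_inner g (\<phi> n) = (\<integral>x. G x * \<phi> n x \<partial>lebesgue)" for n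
    unfolding L2_inner_def set_lebesgue_integral_def
    using ab by (intro Bochner_Integration.integral_cong)
      (auto simp: G_def \<phi>_def exp_bump_def indicator_def)
  moreover have "(\<integral>x. G x \<partial>lebesgue) = (LINT x:{a..b}|lebesgue. g x)"
    by (simp add: G_def set_lebesgue_integral_def)
  ultimately show ?thesis by (simp add: \<phi>_def)
qed

text \<open>The sets over which the integral of \<open>G\<close> vanishes are closed under complements and countable
  disjoint unions, hence contain all Borel sets and, up to null sets, all Lebesgue sets.\<close>

lemma AE_eq_0_if_interval_integrals_0:
  fixes G :: "real \<Rightarrow> real"
  assumes G: "integrable lebesgue G" and int: "\<And>c d. c \<le> d \<Longrightarrow> (LINT x:{c..d}|lebesgue. G x) = 0"
  shows "AE x in lebesgue. G x = 0"
proof (rule density_unique_real[OF G, of "\<lambda>_. 0"])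
  show "integrable lebesgue (\<lambda>_::real. 0::real)" by simp
  have GS: "set_integrable lebesgue A G" if "A \<in> sets lebesgue" for A
    using G that by (auto simp: set_integrable_def intro: integrable_mult_indicator[of _ lebesgue G, simplified])
  \<comment> \<open>the step for complements needs the integral over the whole line\<close>
  have tot: "(\<integral>x. G x \<partial>lebesgue) = 0"
  proof -
    have "(\<lambda>n. LINT x:{- real n..real n}|lebesgue. G x) \<longlonglongrightarrow> (LINT x:(\<Union>n. {- real n..real n})|lebesgue. G x)"
      by (intro set_integral_cont_up GS) (auto simp: incseq_def)
    moreover have "(\<Union>n. {- real n..real n}) = UNIV"
    proof -
      have "x \<in> (\<Union>n. {- real n..real n})" for x
      proof -
        obtain n where "\<bar>x\<bar> \<le> real n" using real_arch_simple by blast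
        then show ?thesis by (auto intro!: exI[of _ n])
      qed
      then show ?thesis by blast
    qed
    ultimately have "(\<lambda>n::nat. 0) \<longlonglongrightarrow> (LINT x:UNIV|lebesgue. G x)"
      using int by simp
    then show ?thesis by (simp add: LIMSEQ_const_iff set_lebesgue_integral_def)
  qed
  have borel: "(LINT x:A|lebesgue. G x) = 0" if "A \<in> sets borel" for A :: "real set"
    using that
  proof (induction rule: borel_set_induct)
    case empty then show ?case by (simp add: set_lebesgue_integral_def)
  next
    case (interval a b) then show ?case by (rule int)
  next
    case (compl A)
    have "(LINT x:A \<union> -A|lebesgue. G x) = (LINT x:A|lebesgue. G x) + (LINT x:-A|lebesgue. G x)"
      using compl by (intro set_integral_Un GS sets_completionI_sets) auto
    then show ?case using compl tot by (simp add: set_lebesgue_integral_def)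
  next
    case (union f)
    have "(LINT x:(\<Union>i. f i)|lebesgue. G x) = (\<Sum>i. (LINT x:(f i)|lebesgue. G x))"
      using union by (intro lebesgue_integral_countable_add GS sets.countable_UN)
        (auto simp: disjoint_family_on_def intro!: sets_completionI_sets)
    then show ?case using union by simp
  qed
  fix A :: "real set" assume "A \<in> sets lebesgue"
  then obtain S N N' where SN: "A = S \<union> N" "N \<subseteq> N'" "N' \<in> null_sets lborel" "S \<in> sets lborel"
    by (rule sets_completionE)
  have "(LINT x:A|lebesgue. G x) = (LINT x:S|lebesgue. G x)"
  proof (rule set_integral_cong_set)
    show "set_borel_measurable lebesgue A G" "set_borel_measurable lebesgue S G"
      using GS[of A] GS[of S] \<open>A \<in> sets lebesgue\<close> SN
      by (auto simp: set_integrable_def set_borel_measurable_def intro!: sets_completionI_sets)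
    have "N' \<in> null_sets lebesgue" using SN(3) by (rule null_sets_completionI)
    then have "AE x in lebesgue. x \<notin> N'" by (rule AE_not_in)
    then show "AE x in lebesgue. (x \<in> S) = (x \<in> A)"
      by eventually_elim (use SN in auto)
  qed
  also have "\<dots> = 0" using borel SN by simp
  finally show "(LINT x:A|lebesgue. G x) = (LINT x:A|lebesgue. 0)" by simp
qed

lemma fundamental_lemma_calculus_of_variations:
  assumes g1: "locally_integrable g\<^sub>1" and g2: "locally_integrable g\<^sub>2"
    and eq: "\<And>\<phi>. test_function \<phi> \<Longrightarrow> L2_inner g\<^sub>1 \<phi> = L2_inner g\<^sub>2 \<phi>"
  shows "AE x in lebesgue. x \<in> {0<..<1} \<longrightarrow> g\<^sub>1 x = g\<^sub>2 x"
proof -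
  have int: "set_integrable lebesgue {c..d} g\<^sub>1" "set_integrable lebesgue {c..d} g\<^sub>2"
    if "0 < c" "c \<le> d" "d < 1" for c d
    using g1 g2 that by (auto simp: locally_integrable_def)
  have eq_int: "(LINT x:{c..d}|lebesgue. g\<^sub>1 x) = (LINT x:{c..d}|lebesgue. g\<^sub>2 x)"
    if "0 < c" "c < d" "d < 1" for c d
  proof (rule LIMSEQ_unique)
    show "(\<lambda>n. L2_inner g\<^sub>1 (exp_bump 1 0 (1 / real (Suc n)) c d)) \<longlonglongrightarrow> (LINT x:{c..d}|lebesgue. g\<^sub>1 x)"
      using that int by (intro L2_inner_bump_tendsto) auto
    have "(\<lambda>n. L2_inner g\<^sub>2 (exp_bump 1 0 (1 / real (Suc n)) c d)) \<longlonglongrightarrow> (LINT x:{c..d}|lebesgue. g\<^sub>2 x)"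
      using that int by (intro L2_inner_bump_tendsto) auto
    then show "(\<lambda>n. L2_inner g\<^sub>1 (exp_bump 1 0 (1 / real (Suc n)) c d)) \<longlonglongrightarrow> (LINT x:{c..d}|lebesgue. g\<^sub>2 x)"
      using eq[OF test_function_exp_bump[OF that]] by simp
  qed
  have compact: "AE x in lebesgue. x \<in> {a..b} \<longrightarrow> g\<^sub>1 x = g\<^sub>2 x" if ab: "0 < a" "a \<le> b" "b < 1" for a b
  proof -
    define G where "G x = indicator {a..b} x * (g\<^sub>1 x - g\<^sub>2 x)" for x
    have G: "integrable lebesgue G"
      using int[OF ab] by (simp add: G_def[abs_def] set_integrable_def right_diff_distrib)
    have "AE x in lebesgue. G x = 0"
    proof (rule AE_eq_0_if_interval_integrals_0[OF G])
      fix c d :: real assume "c \<le> d"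
      have "(LINT x:{c..d}|lebesgue. G x) = (LINT x:{max a c..min b d}|lebesgue. g\<^sub>1 x - g\<^sub>2 x)"
        unfolding set_lebesgue_integral_def
        by (intro Bochner_Integration.integral_cong) (auto simp: G_def indicator_def)
      also have "\<dots> = 0"
      proof (cases "max a c < min b d")
        case True
        then have "(LINT x:{max a c..min b d}|lebesgue. g\<^sub>1 x - g\<^sub>2 x)
          = (LINT x:{max a c..min b d}|lebesgue. g\<^sub>1 x) - (LINT x:{max a c..min b d}|lebesgue. g\<^sub>2 x)"
          using ab by (intro set_integral_diff int) auto
        then show ?thesis using eq_int[of "max a c" "min b d"] ab True by simp
      next
        case False
        then have "{max a c..min b d} \<subseteq> {max a c}" by auto
        then have "{max a c..min b d} \<in> null_sets lebesgue"
          using null_sets_completion_subset[of _ "{max a c}" lborel] by auto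
        then have "AE x in lebesgue. x \<notin> {max a c..min b d}" by (rule AE_not_in)
        then have "AE x in lebesgue. indicator {max a c..min b d} x *\<^sub>R (g\<^sub>1 x - g\<^sub>2 x) = 0"
          by eventually_elim auto
        then show ?thesis
          unfolding set_lebesgue_integral_def by (rule integral_eq_zero_AE)
      qed
      finally show "(LINT x:{c..d}|lebesgue. G x) = 0" .
    qed
    then show ?thesis by eventually_elim (auto simp: G_def)
  qed
  \<comment> \<open>local integrability only covers compact subintervals, so the unit interval is exhausted by countably many of them\<close>
  have "AE x in lebesgue. \<forall>n. x \<in> {1 / real (n + 2)..1 - 1 / real (n + 2)} \<longrightarrow> g\<^sub>1 x = g\<^sub>2 x"
    unfolding AE_all_countable by (intro allI compact) (auto simp: field_simps)
  then show ?thesis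
  proof (eventually_elim, safe)
    fix x :: real
    assume *: "\<forall>n. x \<in> {1 / real (n + 2)..1 - 1 / real (n + 2)} \<longrightarrow> g\<^sub>1 x = g\<^sub>2 x" and x: "x \<in> {0<..<1}"
    then obtain n where n: "inverse (real (Suc n)) < min x (1 - x)"
      using reals_Archimedean[of "min x (1 - x)"] by auto
    have "1 / real (n + 2) \<le> inverse (real (Suc n))" by (simp add: field_simps)
    then show "g\<^sub>1 x = g\<^sub>2 x" using n by (intro *[rule_format, of n]) auto
  qed
qed

section \<open>Weak derivatives and essential suprema\<close>

lemma test_function_deriv:
  assumes "test_function \<phi>"
  shows "test_function (deriv \<phi>)"
proof -
  obtain a b where ab: "0 < a" "a \<le> b" "b < 1" "\<And>x. x \<notin> {a..b} \<Longrightarrow> \<phi> x = 0"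
    and diff: "\<And>k. (deriv ^^ k) \<phi> differentiable_on UNIV"
    using assms unfolding test_function_def by blast
  have "(deriv ^^ k) (deriv \<phi>) differentiable_on UNIV" for k
    using diff[of "Suc k"] by (simp only: funpow_Suc_right o_def)
  moreover have "deriv \<phi> x = 0" if "x \<notin> {a..b}" for x
  proof -
    have "DERIV (\<lambda>_. 0 :: real) x :> 0" by simp
    then have "DERIV \<phi> x :> 0"
      by (rule has_field_derivative_transform_within_open[of _ _ _ "- {a..b}"])
        (use that ab in auto)
    then show ?thesis by (rule DERIV_imp_deriv)
  qed
  ultimately show ?thesis using ab unfolding test_function_def by blast
qed

lemma test_function_DERIV:
  assumes "test_function \<phi>"
  shows "DERIV \<phi> x :> deriv \<phi> x"
proof -
  have "\<phi> differentiable_on UNIV"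
    using assms unfolding test_function_def by (metis funpow_0)
  then show ?thesis
    by (metis DERIV_deriv_iff_real_differentiable UNIV_I differentiable_on_def)
qed

text \<open>Integration by parts, allowing \<open>f\<close> to have kinks. The boundary terms vanish with the test
  function. Kinks occur because the third derivative of the solution jumps where the wave front is.\<close>

lemma L2_inner_deriv_test_function:
  assumes f: "continuous_on {0..1} f" and g: "set_integrable lebesgue {0..1} g"
    and S: "finite S" and deriv: "\<And>x. x \<in> {0<..<1} - S \<Longrightarrow> DERIV f x :> g x"
    and \<phi>: "test_function \<phi>"
  shows "L2_inner f (deriv \<phi>) = - L2_inner g \<phi>"
proof -
  have c\<phi>: "continuous_on A \<phi>" "continuous_on A (deriv \<phi>)" for A
    by (meson DERIV_continuous_on has_field_derivative_at_within test_function_DERIV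
        test_function_deriv \<phi>)+
  have "\<phi> 0 = 0" "\<phi> 1 = 0"
    using \<phi> unfolding test_function_def by auto
  have int1: "set_integrable lebesgue {0..1} (\<lambda>x. f x * deriv \<phi> x)"
    by (intro absolutely_integrable_continuous_real continuous_intros f c\<phi>)
  have int2: "set_integrable lebesgue {0..1} (\<lambda>x. \<phi> x * g x)"
    by (intro absolutely_integrable_bounded_measurable_product_real g
        compact_imp_bounded compact_continuous_image c\<phi>
        continuous_imp_measurable_on_sets_lebesgue) auto
  have "((\<lambda>x. f x * deriv \<phi> x + \<phi> x * g x) has_integral (f 1 * \<phi> 1 - f 0 * \<phi> 0)) {0..1}"
  proof (rule fundamental_theorem_of_calculus_interior_strong[OF S])
    fix x assume "x \<in> {0<..<1} - S"
    then have "DERIV f x :> g x" by (rule deriv)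
    then have "DERIV (\<lambda>x. f x * \<phi> x) x :> f x * deriv \<phi> x + \<phi> x * g x"
      using test_function_DERIV[OF \<phi>] by (auto intro!: derivative_eq_intros)
    then show "((\<lambda>x. f x * \<phi> x) has_vector_derivative f x * deriv \<phi> x + \<phi> x * g x) (at x)"
      by (rule has_real_derivative_iff_has_vector_derivative[THEN iffD1])
  qed (auto intro!: continuous_intros f c\<phi>)
  then have "integral {0..1} (\<lambda>x. f x * deriv \<phi> x + \<phi> x * g x) = 0"
    using \<open>\<phi> 0 = 0\<close> \<open>\<phi> 1 = 0\<close> by (simp add: integral_unique)
  then have "(LINT x:{0..1}|lebesgue. f x * deriv \<phi> x + \<phi> x * g x) = 0"
    using set_lebesgue_integral_eq_integral(2)[OF set_integral_add(1)[OF int1 int2]] by simp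
  then have "(LINT x:{0..1}|lebesgue. f x * deriv \<phi> x) + (LINT x:{0..1}|lebesgue. \<phi> x * g x) = 0"
    by (simp add: set_integral_add(2)[OF int1 int2])
  then show ?thesis by (simp add: L2_inner_def mult.commute[of "\<phi> _"])
qed

lemma has_weak_derivative_unique:
  assumes "has_weak_derivative k f g" "has_weak_derivative k f g'"
  shows "AE x in lebesgue. x \<in> {0<..<1} \<longrightarrow> g x = g' x"
  using assms by (intro fundamental_lemma_calculus_of_variations) (auto simp: has_weak_derivative_def)

lemma L2_inner_cong:
  assumes "\<And>x. x \<in> {0..1} \<Longrightarrow> f x * g x = f' x * g' x"
  shows "L2_inner f g = L2_inner f' g'"
  unfolding L2_inner_def using assms by (intro set_lebesgue_integral_cong) auto

text \<open>Weak derivatives only see the unit interval. This matters because the solution is known there only,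
  while the travelling wave is a function on the whole line.\<close>

lemma has_weak_derivative_cong:
  assumes "\<And>x. x \<in> {0..1} \<Longrightarrow> f x = f' x"
  shows "has_weak_derivative k f g \<longleftrightarrow> has_weak_derivative k f' g"
proof -
  have "set_integrable lebesgue {a..b} f \<longleftrightarrow> set_integrable lebesgue {a..b} f'"
    if "0 < a" "a \<le> b" "b < 1" for a b
    using assms that by (intro set_integrable_cong) auto
  moreover have "L2_inner f \<phi> = L2_inner f' \<phi>" for \<phi>
    using assms by (intro L2_inner_cong) auto
  ultimately show ?thesis by (auto simp: has_weak_derivative_def locally_integrable_def)
qed

text \<open>The function \<open>g\<close> will be a weak derivative, of which nothing is known but that it agrees almost
  everywhere with an explicit function \<open>h\<close>. The bound also serves to show that the essential supremum
  is finite, so that the norm is not merely the default value \<open>0\<close> of the conversion to a real number.\<close>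

lemma Linf_norm_le:
  assumes "AE x in lebesgue. x \<in> {0<..<1} \<longrightarrow> g x = h x" "h \<in> borel_measurable borel"
    "\<And>x. x \<in> {0<..<1} \<Longrightarrow> \<bar>h x\<bar> \<le> K" "0 \<le> K"
  shows "Linf_norm g \<le> K"
    and "AE x in lebesgue. x \<in> {0<..<1} \<longrightarrow> \<bar>g x\<bar> \<le> Linf_norm g"
proof -
  let ?M = "restrict_space lebesgue {0<..<1 :: real}"
  \<comment> \<open>Outside the interval g is arbitrary; replacing it by h there gives a function that is measurable as a whole.\<close>
  define g' where "g' x = (if x \<in> {0<..<1} then g x else h x)" for x
  have "g' \<in> borel_measurable lebesgue"
  proof (rule borel_measurable_AE)
    show "h \<in> borel_measurable lebesgue" using assms(2) by (simp add: measurable_completion)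
    show "AE x in lebesgue. h x = g' x" using assms(1) by eventually_elim (auto simp: g'_def)
  qed
  then have "g' \<in> borel_measurable ?M" by (rule measurable_restrict_space1)
  then have g: "g \<in> borel_measurable ?M"
    by (rule measurable_cong[THEN iffD1, rotated]) (auto simp: g'_def space_restrict_space)
  have AE_M: "(AE x in ?M. P x) \<longleftrightarrow> (AE x in lebesgue. x \<in> {0<..<1} \<longrightarrow> P x)" for P
    by (rule AE_restrict_space_iff) auto
  have "AE x in lebesgue. x \<in> {0<..<1} \<longrightarrow> \<bar>g x\<bar> \<le> K"
    using assms(1) by eventually_elim (use assms(3) in auto)
  then have le: "esssup ?M (\<lambda>x. ereal \<bar>g x\<bar>) \<le> ereal K"
    using g by (intro esssup_I) (auto simp: AE_M)
  then show "Linf_norm g \<le> K"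
    unfolding Linf_norm_def using assms(4)
    by (cases "esssup ?M (\<lambda>x. ereal \<bar>g x\<bar>)") auto
  have "AE x in ?M. ereal \<bar>g x\<bar> \<le> esssup ?M (\<lambda>x. ereal \<bar>g x\<bar>)" by (rule esssup_AE)
  then have "AE x in ?M. \<bar>g x\<bar> \<le> Linf_norm g"
    unfolding Linf_norm_def
    by eventually_elim (use le in \<open>cases "esssup ?M (\<lambda>x. ereal \<bar>g x\<bar>)"; auto\<close>)
  then show "AE x in lebesgue. x \<in> {0<..<1} \<longrightarrow> \<bar>g x\<bar> \<le> Linf_norm g" by (simp add: AE_M)
qed

section \<open>Travelling wave profiles\<close>

text \<open>The functions \<open>w 0, \<dots>, w 3\<close> are the initial value of the transport problem and its derivatives,
  extended by zero to the left of \<open>0\<close> and in some smooth way to the right of \<open>1\<close>, which spares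
  one-sided derivatives at \<open>1\<close>. The third derivative may jump at \<open>0\<close>; its continuous part \<open>d\<close> is kept separately, because the continuity of
  \<open>d\<close> turns almost-everywhere bounds for \<open>w 3\<close> into bounds for its maximum \<open>K\<close>.\<close>

locale wave_profile =
  fixes w :: "nat \<Rightarrow> real \<Rightarrow> real" and d :: "real \<Rightarrow> real" and K :: real
  assumes deriv_w: "k < 2 \<Longrightarrow> DERIV (w k) y :> w (Suc k) y"
    and deriv_w2: "y < 1 \<Longrightarrow> y \<noteq> 0 \<Longrightarrow> DERIV (w 2) y :> w 3 y"
    and cont_w2: "continuous_on UNIV (w 2)"
    and w_nonpos: "k \<le> 2 \<Longrightarrow> y \<le> 0 \<Longrightarrow> w k y = 0"
    and w3: "w 3 y = (if 0 < y then d y else 0)"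
    and cont_d: "continuous_on UNIV d"
    and d_bound: "\<bar>d y\<bar> \<le> K"
    and d_attained: "\<exists>y\<in>{0..1}. \<bar>d y\<bar> = K"
begin

lemma K_nonneg: "0 \<le> K"
  using d_bound[of 0] by linarith

lemma w3_bound: "\<bar>w 3 y\<bar> \<le> K"
  using d_bound[of y] K_nonneg by (simp add: w3)

lemma cont_w: "k \<le> 2 \<Longrightarrow> continuous_on A (w k)"
proof (cases "k = 2")
  case True then show ?thesis using cont_w2 by (auto intro: continuous_on_subset)
next
  case False
  assume "k \<le> 2"
  with False have "k < 2" by simp
  then show ?thesis
    using deriv_w by (intro DERIV_continuous_on[of A "w k" "w (Suc k)"]) (rule has_field_derivative_at_within)
qed

text \<open>The mean value theorem on the positive side; to the left of the kink at \<open>0\<close> the function vanishes.\<close>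

lemma w2_lipschitz:
  assumes "x \<le> 1" "y \<le> 1"
  shows "\<bar>w 2 y - w 2 x\<bar> \<le> K * \<bar>y - x\<bar>"
proof -
  have *: "\<bar>w 2 y - w 2 x\<bar> \<le> K * (y - x)" if "x < y" "y \<le> 1" "0 \<le> x" for x y
  proof -
    have der: "(w 2 has_derivative (\<lambda>h. w 3 z * h)) (at z)" if "x < z" "z < y" for z
      using deriv_w2[of z] that \<open>y \<le> 1\<close> \<open>0 \<le> x\<close> by (simp add: has_field_derivative_def)
    obtain z where "x < z" "z < y" "w 2 y - w 2 x = w 3 z * (y - x)"
      using mvt[OF \<open>x < y\<close> cont_w[OF order_refl] der] by blast
    then show ?thesis using w3_bound[of z] that by (simp add: abs_mult mult_right_mono)
  qed
  have **: "\<bar>w 2 y - w 2 x\<bar> \<le> K * (y - x)" if "x \<le> y" "y \<le> 1" for x y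
  proof (cases "x \<le> 0")
    case True
    show ?thesis
    proof (cases "y \<le> 0")
      case True then show ?thesis using that K_nonneg by (simp add: w_nonpos)
    next
      case False
      have "\<bar>w 2 y - w 2 0\<bar> \<le> K * (y - 0)" using False that by (intro *) auto
      also have "\<dots> \<le> K * (y - x)" using K_nonneg True by (intro mult_left_mono) auto
      finally show ?thesis using True by (simp add: w_nonpos)
    qed
  next
    case False then show ?thesis using *[of x y] that by (cases "x = y") auto
  qed
  show ?thesis using **[of x y] **[of y x] assms by (cases "x \<le> y") (auto simp: abs_minus_commute)
qed

text \<open>Each \<open>w k\<close> vanishes at \<open>0\<close> and the interval \<open>[0, 1]\<close> has length one, so that a bound for the
  derivative is a bound for the function.\<close>

lemma w_bound:
  assumes "y \<le> 1" "k \<le> 3"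
  shows "\<bar>w k y\<bar> \<le> K"
proof -
  have 2: "\<bar>w 2 y\<bar> \<le> K" if "y \<le> 1" for y
  proof (cases "y \<le> 0")
    case True then show ?thesis using K_nonneg by (simp add: w_nonpos)
  next
    case False
    then have "\<bar>w 2 y\<bar> \<le> K * y" using w2_lipschitz[of 0 y] that by (simp add: w_nonpos)
    also have "\<dots> \<le> K" using that K_nonneg by (intro mult_left_le) auto
    finally show ?thesis .
  qed
  have step: "\<bar>w k y\<bar> \<le> K" if "y \<le> 1" "k < 2" "\<And>y. y \<le> 1 \<Longrightarrow> \<bar>w (Suc k) y\<bar> \<le> K" for y k
  proof (cases "y \<le> 0")
    case True then show ?thesis using K_nonneg that by (simp add: w_nonpos)
  next
    case False
    then obtain z where "0 < z" "z < y" "w k y - w k 0 = (y - 0) * w (Suc k) z"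
      using MVT2[of 0 y "w k" "w (Suc k)"] deriv_w[OF \<open>k < 2\<close>] by auto
    then have "\<bar>w k y\<bar> = y * \<bar>w (Suc k) z\<bar>" using that by (simp add: w_nonpos abs_mult)
    also have "\<dots> \<le> 1 * K" using that \<open>z < y\<close> \<open>0 < z\<close> by (intro mult_mono) auto
    finally show ?thesis by simp
  qed
  have 1: "\<bar>w 1 y\<bar> \<le> K" if "y \<le> 1" for y
    using step[of y 1] that 2 by (simp add: numeral_2_eq_2)
  have 0: "\<bar>w 0 y\<bar> \<le> K" if "y \<le> 1" for y
    using step[of y 0] that 1 by simp
  have "k = 0 \<or> k = 1 \<or> k = 2 \<or> k = 3" using assms(2) by auto
  then show ?thesis using 0 1 2 w3_bound assms by auto
qed

lemma w_measurable:
  assumes "k \<le> 3"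
  shows "(\<lambda>x. w k (x - t)) \<in> borel_measurable borel"
proof -
  have "w k \<in> borel_measurable borel"
  proof (cases "k = 3")
    case True
    have "d \<in> borel_measurable borel" by (intro borel_measurable_continuous_onI cont_d)
    then have "(\<lambda>y. if 0 < y then d y else 0) \<in> borel_measurable borel" by measurable
    moreover have "w k = (\<lambda>y. if 0 < y then d y else 0)" using True w3 by auto
    ultimately show ?thesis by simp
  next
    case False
    then show ?thesis using assms by (intro borel_measurable_continuous_onI cont_w) auto
  qed
  then show ?thesis by measurable
qed

lemma w_integrable:
  assumes "k \<le> 3" "0 \<le> t" 
  shows "set_integrable lebesgue {0..1} (\<lambda>x. w k (x - t))"
proof -
  have "integrable lebesgue (\<lambda>x :: real. indicat_real {0..1} x * K)"
    by (intro integrable_mult_left integrable_real_indicator) auto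
  then show ?thesis
    unfolding set_integrable_def
  proof (rule Bochner_Integration.integrable_bound)
    show "(\<lambda>x. indicator {0..1} x *\<^sub>R w k (x - t)) \<in> borel_measurable lebesgue"
      using w_measurable[OF assms(1), of t]
      by (intro borel_measurable_scaleR borel_measurable_indicator) (auto simp: measurable_completion)
    show "AE x in lebesgue. norm (indicat_real {0..1} x *\<^sub>R w k (x - t)) \<le> norm (indicat_real {0..1} x * K)"
    proof (rule AE_I2)
      fix x :: real
      show "norm (indicat_real {0..1} x *\<^sub>R w k (x - t)) \<le> norm (indicat_real {0..1} x * K)"
      proof (cases "x \<in> {0..1}")
        case True
        then have "\<bar>w k (x - t)\<bar> \<le> K" using assms by (intro w_bound) auto
        then show ?thesis using True by simp
      qed simp
    qed
  qed
qed

lemma has_weak_derivative_w: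
  assumes "k \<le> 3" "0 \<le> t"
  shows "has_weak_derivative k (\<lambda>x. w 0 (x - t)) (\<lambda>x. w k (x - t))"
proof -
  have loc: "locally_integrable (\<lambda>x. w k (x - t))" if "k \<le> 3" for k
    unfolding locally_integrable_def
  proof (intro allI impI)
    fix a b :: real assume "0 < a" "a \<le> b" "b < 1"
    then show "set_integrable lebesgue {a..b} (\<lambda>x. w k (x - t))"
      by (intro set_integrable_subset[OF w_integrable[OF that assms(2)]]) auto
  qed
  have "L2_inner (\<lambda>x. w 0 (x - t)) ((deriv ^^ k) \<phi>) = (-1) ^ k * L2_inner (\<lambda>x. w k (x - t)) \<phi>"
    if "test_function \<phi>" for \<phi>
    using assms(1) that
  proof (induction k arbitrary: \<phi>)
    case (Suc k)
    have der: "DERIV (\<lambda>x. w k (x - t)) x :> w (Suc k) (x - t)" if "x \<in> {0<..<1} - {t}" for x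
    proof -
      have "DERIV (w k) (x - t) :> w (Suc k) (x - t)"
      proof (cases "k = 2")
        case True
        then have "w k = w 2" "w (Suc k) = w 3" by simp_all
        moreover have "DERIV (w 2) (x - t) :> w 3 (x - t)"
          using that assms(2) by (intro deriv_w2) simp_all
        ultimately show ?thesis by simp
      next
        case False
        then show ?thesis using Suc.prems by (intro deriv_w) auto
      qed
      then show ?thesis using DERIV_shift[of "w k" "w (Suc k) (x - t)" x "- t"] by simp
    qed
    have cont: "continuous_on {0..1} (\<lambda>x. w k (x - t))"
      using Suc.prems by (intro continuous_on_compose2[OF cont_w[of k UNIV], of _ "\<lambda>x. x - t"])
        (simp_all add: continuous_on_diff continuous_on_id continuous_on_const)
    have "L2_inner (\<lambda>x. w k (x - t)) (deriv \<phi>) = - L2_inner (\<lambda>x. w (Suc k) (x - t)) \<phi>"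
      by (rule L2_inner_deriv_test_function[where S = "{t}", OF cont w_integrable[OF Suc.prems(1) assms(2)] _ der Suc.prems(2)])
        simp_all
    moreover have "L2_inner (\<lambda>x. w 0 (x - t)) ((deriv ^^ k) (deriv \<phi>))
        = (-1) ^ k * L2_inner (\<lambda>x. w k (x - t)) (deriv \<phi>)"
      using Suc.prems(1) by (intro Suc.IH test_function_deriv Suc.prems(2)) simp
    moreover have "(deriv ^^ Suc k) \<phi> = (deriv ^^ k) (deriv \<phi>)"
      by (simp only: funpow_Suc_right o_def)
    ultimately show ?case by (simp only: power_Suc mult_minus_left mult_minus_right mult_1_left)
  qed (simp only: funpow_0 power_0 mult_1_left)
  then show ?thesis
    unfolding has_weak_derivative_def using loc[OF zero_le] loc[OF assms(1)] by (intro conjI allI impI)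
qed

lemma Linf_norm_weak_derivative:
  assumes "k \<le> 3" "0 \<le> t" "\<And>x. x \<in> {0..1} \<Longrightarrow> f x = w 0 (x - t)"
  shows "Linf_norm (weak_derivative k f) \<le> K"
    and "AE x in lebesgue. x \<in> {0<..<1} \<longrightarrow> \<bar>w k (x - t)\<bar> \<le> Linf_norm (weak_derivative k f)"
proof -
  have wd: "has_weak_derivative k f (\<lambda>x. w k (x - t))"
    using has_weak_derivative_w[OF assms(1,2)] has_weak_derivative_cong[OF assms(3)] by simp
  then have "has_weak_derivative k f (weak_derivative k f)"
    unfolding weak_derivative_def by (rule someI[of "has_weak_derivative k f"])
  then have AE: "AE x in lebesgue. x \<in> {0<..<1} \<longrightarrow> weak_derivative k f x = w k (x - t)"
    using wd by (rule has_weak_derivative_unique)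
  have bound: "\<bar>w k (x - t)\<bar> \<le> K" if "x \<in> {0<..<1}" for x
    using that assms by (intro w_bound) auto
  note * = Linf_norm_le[OF AE w_measurable[OF assms(1)] _ K_nonneg]
  show "Linf_norm (weak_derivative k f) \<le> K" by (rule *(1)) (rule bound)
  have AE': "AE x in lebesgue. x \<in> {0<..<1} \<longrightarrow> \<bar>weak_derivative k f x\<bar> \<le> Linf_norm (weak_derivative k f)"
    by (rule *(2)) (rule bound)
  show "AE x in lebesgue. x \<in> {0<..<1} \<longrightarrow> \<bar>w k (x - t)\<bar> \<le> Linf_norm (weak_derivative k f)"
    using AE AE' by eventually_elim auto
qed

lemma Winf_norm_le:
  assumes "0 \<le> t" "\<And>x. x \<in> {0..1} \<Longrightarrow> f x = w 0 (x - t)"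
  shows "Winf_norm 3 f \<le> K"
  unfolding Winf_norm_def
proof (rule Max.boundedI)
  fix a assume "a \<in> (\<lambda>k. Linf_norm (weak_derivative k f)) ` {..3}"
  then obtain k where "k \<le> 3" "a = Linf_norm (weak_derivative k f)"
    by (auto simp only: atMost_iff)
  then show "a \<le> K" using Linf_norm_weak_derivative(1)[OF \<open>k \<le> 3\<close> assms] by simp
qed simp_all

text \<open>The essential supremum bounds \<open>\<bar>d\<bar>\<close> almost everywhere, hence everywhere by continuity, including the
  point where \<open>K\<close> is attained.\<close>

lemma Winf_norm_ge:
  assumes "\<And>x. x \<in> {0..1} \<Longrightarrow> f x = w 0 x"
  shows "K \<le> Winf_norm 3 f"
proof -
  define c where "c = Linf_norm (weak_derivative 3 f)"
  have "AE x in lebesgue. x \<in> {0<..<1} \<longrightarrow> \<bar>w 3 x\<bar> \<le> c"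
    using Linf_norm_weak_derivative(2)[of 3 0 f, OF order_refl order_refl] assms by (simp add: c_def)
  then have "AE x in lebesgue. x \<in> {0<..<1} \<longrightarrow> x \<in> {y. \<bar>d y\<bar> \<le> c}"
    by eventually_elim (auto simp: w3)
  moreover have closed: "closed {y. \<bar>d y\<bar> \<le> c}"
    by (intro closed_Collect_le continuous_intros cont_d)
  ultimately have "{0<..<1} \<subseteq> {y. \<bar>d y\<bar> \<le> c}"
    by (intro subsetI mem_closed_if_AE_lebesgue_open[of "{0<..<1}" "{y. \<bar>d y\<bar> \<le> c}"]) auto
  then have "closure {0<..<1} \<subseteq> {y. \<bar>d y\<bar> \<le> c}" using closed by (rule closure_minimal)
  then have "K \<le> c" using d_attained by auto
  also have "c \<le> Winf_norm 3 f" unfolding c_def Winf_norm_def by (intro Max_ge) auto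
  finally show ?thesis .
qed

end

text \<open>For extending the initial value: an antiderivative on the whole line spares the one-sided
  derivatives at the end points of the unit interval in all later arguments.\<close>

lemma antiderivative_exists:
  fixes f :: "real \<Rightarrow> real"
  assumes "continuous_on UNIV f" "\<And>y. y \<le> 0 \<Longrightarrow> f y = 0"
  obtains F where "\<And>y. DERIV F y :> f y" "\<And>y. y \<le> 0 \<Longrightarrow> F y = 0"
proof -
  have "\<exists>F. \<forall>x :: real. -\<infinity> < ereal x \<longrightarrow> ereal x < \<infinity> \<longrightarrow> (F has_vector_derivative f x) (at x)"
    using assms(1) by (intro einterval_antiderivative) (auto simp: continuous_on_eq_continuous_at)
  then obtain G where G: "\<And>x. DERIV G x :> f x"
    by (auto simp: has_real_derivative_iff_has_vector_derivative)
  show thesis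
  proof
    show "DERIV (\<lambda>y. G y - G 0) y :> f y" for y
      using DERIV_diff[OF G[of y] DERIV_const] by simp
    show "G y - G 0 = 0" if "y \<le> 0" for y
    proof (cases "y = 0")
      case False
      then have "y < 0" using that by simp
      then obtain z where "z < 0" "G 0 - G y = (0 - y) * f z"
        using MVT2[of y 0 G f] G by auto
      then show ?thesis using assms(2)[of z] by simp
    qed simp
  qed
qed

lemma eq_if_derivatives_eq:
  fixes F G :: "real \<Rightarrow> real"
  assumes F: "\<And>y. DERIV F y :> f y"
    and G: "\<And>y. y \<in> {0..1} \<Longrightarrow> (G has_real_derivative f y) (at y within {0..1})"
    and "F 0 = G 0" "x \<in> {0..1}"
  shows "F x = G x"
proof -
  have "((\<lambda>y. F y - G y) has_real_derivative 0) (at y within {0..1})" if "y \<in> {0..1}" for y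
    using DERIV_diff[OF has_field_derivative_at_within[OF F] G[OF that]] by simp
  then have "\<exists>c. \<forall>y\<in>{0..1}. F y - G y = c"
    using has_field_derivative_zero_constant[of "{0..1::real}" "\<lambda>y. F y - G y"] by auto
  then obtain c where c: "\<And>y. y \<in> {0..1} \<Longrightarrow> F y - G y = c" by blast
  from c[of 0] c[of x] assms(3,4) show ?thesis by simp
qed

text \<open>Only the second derivative is extended explicitly, by its end values; this keeps it continuous as it
  vanishes at \<open>0\<close>. The lower ones are antiderivatives of it that vanish on the negative axis, and
  they coincide with the given function and its derivative on \<open>[0, 1]\<close>, having the same derivatives
  and the same value at \<open>0\<close>.\<close>

lemma wave_profile_exists:
  assumes f: "C_k_on 3 {0..1} f"
    and f0: "f 0 = 0" "derivative_on {0..1} f 0 = 0" "(derivative_on {0..1} ^^ 2) f 0 = 0"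
  obtains w d K where "wave_profile w d K" "\<And>x. x \<in> {0..1} \<Longrightarrow> w 0 x = f x"
proof -
  define D where "D k = (derivative_on {0..1} ^^ k) f" for k
  define clamp :: "real \<Rightarrow> real" where "clamp y = max 0 (min 1 y)" for y
  have der: "(D k has_real_derivative D (Suc k) x) (at x within {0..1})" if "k < 3" "x \<in> {0..1}" for k x
  proof -
    have "D k differentiable (at x within {0..1})"
      using f that by (auto simp: C_k_on_def differentiable_on_def D_def)
    then show ?thesis
      by (simp add: D_def derivative_on_def vector_derivative_works
          has_real_derivative_iff_has_vector_derivative)
  qed
  have cont: "continuous_on UNIV (\<lambda>y. D k (clamp y))" if "k \<le> 3" for k
  proof (rule continuous_on_compose2[of "{0..1}" "D k"])
    show "continuous_on {0..1} (D k)" using f that by (auto simp: C_k_on_def D_def)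
    show "continuous_on UNIV clamp" unfolding clamp_def by (intro continuous_intros)
  qed (auto simp: clamp_def)
  have D0: "D 0 = f" "D 1 0 = 0" "D 2 0 = 0"
    using f0 by (simp_all add: D_def)
  define w2 where "w2 y = D 2 (clamp y)" for y
  define d where "d y = D 3 (clamp y)" for y
  have w2_nonpos: "w2 y = 0" if "y \<le> 0" for y
    using that D0 by (simp add: w2_def clamp_def max_def min_def)
  have cont_w2: "continuous_on UNIV w2" and cont_d: "continuous_on UNIV d"
    using cont[of 2] cont[of 3] by (auto simp: w2_def[abs_def] d_def[abs_def])
  obtain w1 where w1: "\<And>y. DERIV w1 y :> w2 y" and w1_nonpos: "\<And>y. y \<le> 0 \<Longrightarrow> w1 y = 0"
    using antiderivative_exists[OF cont_w2 w2_nonpos] by blast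
  have "continuous_on UNIV w1" by (rule DERIV_continuous_on[OF w1])
  from antiderivative_exists[OF this w1_nonpos]
  obtain w0 where w0: "\<And>y. DERIV w0 y :> w1 y" and w0_nonpos: "\<And>y. y \<le> 0 \<Longrightarrow> w0 y = 0"
    by metis
  have w2_eq: "w2 y = D 2 y" if "y \<in> {0..1}" for y
    using that by (simp add: w2_def clamp_def)
  have w1_eq: "w1 y = D 1 y" if "y \<in> {0..1}" for y
    by (rule eq_if_derivatives_eq[OF w1 _ _ that])
      (use der[of 1] w2_eq w1_nonpos D0 in \<open>auto simp: numeral_2_eq_2\<close>)
  have w0_eq: "w0 y = f y" if "y \<in> {0..1}" for y
    by (rule eq_if_derivatives_eq[OF w0 _ _ that])
      (use der[of 0] w1_eq w0_nonpos D0 f0 in auto)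
  have "\<exists>y\<in>{0..1}. \<forall>z\<in>{0..1}. \<bar>d z\<bar> \<le> \<bar>d y\<bar>"
    by (rule continuous_attains_sup[of "{0..1::real}" "\<lambda>y. \<bar>d y\<bar>"])
      (auto intro!: continuous_on_subset[OF cont_d] continuous_intros)
  then obtain y0 where y0: "y0 \<in> {0..1}" "\<And>z. z \<in> {0..1} \<Longrightarrow> \<bar>d z\<bar> \<le> \<bar>d y0\<bar>" by blast
  define w where "w k = (if k = 0 then w0 else if k = 1 then w1 else if k = 2 then w2
    else (\<lambda>y. if 0 < y then d y else 0))" for k :: nat
  have w_simps: "w 0 = w0" "w (Suc 0) = w1" "w 2 = w2" "w 3 = (\<lambda>y. if 0 < y then d y else 0)"
    "w (Suc (Suc 0)) = w2"
    by (simp_all add: w_def)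
  have "wave_profile w d \<bar>d y0\<bar>"
  proof
    fix k y assume "k < (2::nat)"
    then have "k = 0 \<or> k = Suc 0" by auto
    then show "DERIV (w k) y :> w (Suc k) y" using w0 w1 by (auto simp: w_simps)
  next
    fix y :: real assume y: "y < 1" "y \<noteq> 0"
    show "DERIV (w 2) y :> w 3 y"
    proof (cases "y < 0")
      case True
      have "DERIV (\<lambda>_. 0 :: real) y :> 0" by simp
      then have "DERIV w2 y :> 0"
        by (rule has_field_derivative_transform_within_open[of _ _ _ "{..<0}"])
          (use True w2_nonpos in auto)
      then show ?thesis using True by (simp add: w_simps)
    next
      case False
      then have y': "y \<in> {0<..<1}" using y by auto
      then have "(D 2 has_real_derivative D 3 y) (at y within {0<..<1})"
        using der[of 2 y] by (auto intro: has_field_derivative_subset simp: eval_nat_numeral)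
      then have "DERIV (D 2) y :> D 3 y" by (simp only: at_within_open[OF y' open_greaterThanLessThan])
      then have "DERIV w2 y :> D 3 y"
        by (rule has_field_derivative_transform_within_open[of _ _ _ "{0<..<1}"])
          (use y' w2_eq in auto)
      then show ?thesis using y' by (simp add: w_simps d_def clamp_def)
    qed
  next
    fix k :: nat and y :: real assume "k \<le> 2" "y \<le> 0"
    then have "k = 0 \<or> k = Suc 0 \<or> k = 2" by auto
    then show "w k y = 0" using \<open>y \<le> 0\<close> w0_nonpos w1_nonpos w2_nonpos by (auto simp: w_simps)
  next
    fix y
    have "d y = d (clamp y)" by (simp add: d_def clamp_def)
    moreover have "clamp y \<in> {0..1}" by (simp add: clamp_def)
    ultimately show "\<bar>d y\<bar> \<le> \<bar>d y0\<bar>" using y0(2) by metis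
  qed (use cont_w2 cont_d y0(1) in \<open>auto simp: w_simps\<close>)
  then show thesis by (rule that) (use w0_eq in \<open>simp add: w_simps\<close>)
qed

lemma transport_solution_derivatives:
  assumes "0 < T" "transport_solution T f \<eta>" "t \<in> {0..T}" "x \<in> {0..1}"
  defines "p \<equiv> derivative_on {0..1} (\<eta> t) x"
  shows "((\<lambda>s. \<eta> s x) has_real_derivative - p) (at t within {0..T})"
    and "(\<eta> t has_real_derivative p) (at x within {0..1})"
proof -
  have d: "\<eta> t differentiable (at x within {0..1})" "(\<lambda>s. \<eta> s x) differentiable (at t within {0..T})"
    using assms unfolding transport_solution_def differentiable_on_def by blast+
  have eq: "derivative_on {0..T} (\<lambda>s. \<eta> s x) t = - p"
    using assms(2-4) unfolding transport_solution_def p_def by (auto simp: eq_neg_iff_add_eq_0)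
  show "(\<eta> t has_real_derivative p) (at x within {0..1})"
    using d(1) by (simp add: p_def derivative_on_def vector_derivative_works
        has_real_derivative_iff_has_vector_derivative)
  show "((\<lambda>s. \<eta> s x) has_real_derivative - p) (at t within {0..T})"
    using d(2) eq by (simp add: derivative_on_def vector_derivative_works
        has_real_derivative_iff_has_vector_derivative)
qed

text \<open>The partial derivatives of \<open>\<eta>\<close> are continuous on the closed rectangle, so \<open>\<eta>\<close> is totally
  differentiable relative to it, and the equation says that the derivative in the direction \<open>(1, 1)\<close>
  is zero.\<close>

lemma transport_solution_constant_on_characteristics:
  assumes T: "0 < T" and sol: "transport_solution T f \<eta>"
    and r: "0 \<le> r" "t\<^sub>0 \<in> {0..T}" "t\<^sub>0 + r \<in> {0..T}" "x\<^sub>0 \<in> {0..1}" "x\<^sub>0 + r \<in> {0..1}"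
  shows "\<eta> (t\<^sub>0 + r) (x\<^sub>0 + r) = \<eta> t\<^sub>0 x\<^sub>0"
proof -
  define p where "p t x = derivative_on {0..1} (\<eta> t) x" for t x
  note der = transport_solution_derivatives[OF T sol, folded p_def]
  have cont_p: "continuous_on ({0..T} \<times> {0..1}) (\<lambda>(t, x). p t x)"
    using sol by (simp add: transport_solution_def p_def)
  have total: "((\<lambda>(t, x). \<eta> t x) has_derivative (\<lambda>(s, y). - p t x * s + p t x * y))
      (at (t, x) within {0..T} \<times> {0..1})" if "t \<in> {0..T}" "x \<in> {0..1}" for t x
  proof -
    have "((\<lambda>(t, x). \<eta> t x) has_derivative (\<lambda>(s, y). - p t x * s + blinfun_apply (blinfun_scaleR_left (p t x)) y))
        (at (t, x) within {0..T} \<times> {0..1})"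
    proof (rule has_derivative_partialsI)
      show "((\<lambda>t. \<eta> t x) has_derivative (*) (- p t x)) (at t within {0..T})"
        using der(1)[OF that] by (simp add: has_field_derivative_def)
      show "(\<eta> t has_derivative blinfun_apply (blinfun_scaleR_left (p t x))) (at x within {0..1})"
        if "t \<in> {0..T}" "x \<in> {0..1}" for t x
        using der(2)[OF that] by (rule has_derivative_eq_rhs[OF has_field_derivative_imp_has_derivative])
          (simp add: fun_eq_iff mult.commute)
      have "continuous_on ({0..T} \<times> {0..1}) (\<lambda>(t, x). blinfun_scaleR_left (p t x) :: real \<Rightarrow>\<^sub>L real)"
        using cont_p by (auto simp: split_beta' intro!: continuous_intros)
      then show "continuous (at (t, x) within {0..T} \<times> {0..1}) (\<lambda>(t, x). blinfun_scaleR_left (p t x) :: real \<Rightarrow>\<^sub>L real)"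
        using that by (simp add: continuous_on_eq_continuous_within)
    qed (use that in auto)
    then show ?thesis by (simp add: mult.commute)
  qed
  define g where "g s = \<eta> (t\<^sub>0 + s) (x\<^sub>0 + s)" for s
  have "(g has_derivative (\<lambda>h. 0)) (at s within {0..r})" if "s \<in> {0..r}" for s
  proof -
    have "((\<lambda>(t, x). \<eta> t x) has_derivative (\<lambda>(h, y). - p (t\<^sub>0 + s) (x\<^sub>0 + s) * h + p (t\<^sub>0 + s) (x\<^sub>0 + s) * y))
      (at (t\<^sub>0 + s, x\<^sub>0 + s) within (\<lambda>s. (t\<^sub>0 + s, x\<^sub>0 + s)) ` {0..r})"
      by (rule has_derivative_subset[OF total]) (use that r in auto)
    moreover have "((\<lambda>s. (t\<^sub>0 + s, x\<^sub>0 + s)) has_derivative (\<lambda>h. (h, h))) (at s within {0..r})"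
      by (auto intro!: derivative_eq_intros)
    ultimately have "((\<lambda>s. case (t\<^sub>0 + s, x\<^sub>0 + s) of (t, x) \<Rightarrow> \<eta> t x) has_derivative
        (\<lambda>h. case (h, h) of (h, y) \<Rightarrow> - p (t\<^sub>0 + s) (x\<^sub>0 + s) * h + p (t\<^sub>0 + s) (x\<^sub>0 + s) * y)) (at s within {0..r})"
      by (rule has_derivative_in_compose[rotated])
    then show ?thesis by (simp add: g_def[abs_def])
  qed
  then obtain c where "\<And>s. s \<in> {0..r} \<Longrightarrow> g s = c"
    using has_derivative_zero_constant[of "{0..r}" g] by auto
  then have "g r = g 0" using r by auto
  then show ?thesis by (simp add: g_def)
qed

text \<open>The characteristic through \<open>(t, x)\<close> starts on the initial line if \<open>t \<le> x\<close> and on the inflow boundary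
  otherwise; in both cases the value there is \<open>w 0 (x - t)\<close>.\<close>

lemma (in wave_profile) transport_solution_eq:
  assumes T: "0 < T" and sol: "transport_solution T f \<eta>"
    and f: "\<And>x. x \<in> {0..1} \<Longrightarrow> w 0 x = f x" and tx: "t \<in> {0..T}" "x \<in> {0..1}"
  shows "\<eta> t x = w 0 (x - t)"
proof (cases "t \<le> x")
  case True
  then have "\<eta> (0 + t) (x - t + t) = \<eta> 0 (x - t)"
    using tx by (intro transport_solution_constant_on_characteristics[OF T sol]) auto
  also have "\<dots> = w 0 (x - t)"
    using sol f[of "x - t"] tx True unfolding transport_solution_def by simp
  finally show ?thesis by simp
next
  case False
  then have "\<eta> (t - x + x) (0 + x) = \<eta> (t - x) 0"
    using tx by (intro transport_solution_constant_on_characteristics[OF T sol]) auto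
  also have "\<dots> = w 0 (x - t)"
    using sol tx False w_nonpos[of 0 "x - t"] unfolding transport_solution_def by auto
  finally show ?thesis by simp
qed

section \<open>Piecewise linear functions on the uniform mesh\<close>

lemma S_h_cell:
  assumes "\<phi> \<in> S_h N" "j < N" "x \<in> {real j / real N..real (Suc j) / real N}"
  shows "\<phi> x = \<phi> (real j / real N) + (\<phi> (real (Suc j) / real N) - \<phi> (real j / real N)) * (real N * x - real j)"
proof -
  have "Suc j \<in> {1..N}" using assms(2) by auto
  then obtain p :: "real poly" where deg: "degree p \<le> 1"
    and p: "\<And>x. x \<in> {real j / real N..real (Suc j) / real N} \<Longrightarrow> \<phi> x = poly p x"
    using assms(1) unfolding S_h_def by fastforce
  define a b where "a = coeff p 0" and "b = coeff p 1"
  have poly: "poly p y = a + b * y" for y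
  proof -
    have "p = [:a, b:]"
      using deg by (intro poly_eqI) (auto simp: a_def b_def coeff_pCons coeff_eq_0 split: nat.split)
    then have "poly p y = poly [:a, b:] y" by (rule arg_cong)
    then show ?thesis by (simp add: mult.commute)
  qed
  have ends: "real j / real N \<le> real (Suc j) / real N" by (intro divide_right_mono) auto
  have e: "\<phi> x = a + b * x" "\<phi> (real j / real N) = a + b * (real j / real N)"
    "\<phi> (real (Suc j) / real N) = a + b * (real (Suc j) / real N)"
    using p assms(3) ends poly by auto
  show ?thesis unfolding e using assms(2) by (simp add: field_simps)
qed

definition hat_interp :: "nat \<Rightarrow> (nat \<Rightarrow> real) \<Rightarrow> real \<Rightarrow> real" where
  "hat_interp N v x = (\<Sum>i\<le>N. v i * max 0 (1 - \<bar>real N * x - real i\<bar>))"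

lemma hat_interp_cell:
  assumes "j < N" "x \<in> {real j / real N..real (Suc j) / real N}"
  shows "hat_interp N v x = v j + (v (Suc j) - v j) * (real N * x - real j)"
proof -
  define y where "y = real N * x - real j"
  have y: "0 \<le> y" "y \<le> 1" using assms by (auto simp: y_def field_simps)
  have "hat_interp N v x = (\<Sum>i\<in>{j, Suc j}. v i * max 0 (1 - \<bar>real N * x - real i\<bar>))"
    unfolding hat_interp_def
  proof (rule sum.mono_neutral_right)
    show "\<forall>i\<in>{..N} - {j, Suc j}. v i * max 0 (1 - \<bar>real N * x - real i\<bar>) = 0"
    proof
      fix i assume "i \<in> {..N} - {j, Suc j}"
      then have "real i \<le> real j - 1 \<or> real i \<ge> real j + 2" by auto
      then have "1 - \<bar>real N * x - real i\<bar> \<le> 0" using y unfolding y_def by linarith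
      then show "v i * max 0 (1 - \<bar>real N * x - real i\<bar>) = 0" by simp
    qed
  qed (use assms in auto)
  also have "\<dots> = v j * (1 - y) + v (Suc j) * y"
  proof -
    have "max 0 (1 - \<bar>real N * x - real j\<bar>) = 1 - y" "max 0 (1 - \<bar>real N * x - real (Suc j)\<bar>) = y"
      using y by (auto simp: y_def)
    then show ?thesis by (simp add: y_def)
  qed
  finally show ?thesis by (simp add: y_def algebra_simps)
qed

lemma hat_interp_node:
  assumes "0 < N" "j \<le> N"
  shows "hat_interp N v (real j / real N) = v j"
proof (cases "j < N")
  case True
  have "real j / real N \<in> {real j / real N..real (Suc j) / real N}" by (auto intro: divide_right_mono)
  from hat_interp_cell[OF True this] show ?thesis using assms by simp
next
  case False
  then obtain i where i: "j = Suc i" "i < N" using assms by (cases j) auto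
  have "real j / real N \<in> {real i / real N..real (Suc i) / real N}" using i by (auto intro: divide_right_mono)
  from hat_interp_cell[OF i(2) this] show ?thesis using assms i by simp
qed

lemma hat_interp_in_S_h:
  assumes "0 < N" "v 0 = 0"
  shows "hat_interp N v \<in> S_h N"
proof -
  have "continuous_on {0..1} (hat_interp N v)"
    unfolding hat_interp_def by (intro continuous_intros)
  moreover have "\<exists>p :: real poly. degree p \<le> 1 \<and>
      (\<forall>x\<in>{(real j - 1) / real N..real j / real N}. hat_interp N v x = poly p x)" if "j \<in> {1..N}" for j
  proof -
    obtain i where i: "j = Suc i" "i < N" using \<open>j \<in> {1..N}\<close> by (cases j) auto
    let ?p = "[:v i - (v (Suc i) - v i) * real i, (v (Suc i) - v i) * real N:]"
    have "hat_interp N v x = poly ?p x" if "x \<in> {(real j - 1) / real N..real j / real N}" for x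
      using hat_interp_cell[OF i(2), of x v] that i by (simp add: algebra_simps)
    then show ?thesis by (intro exI[of _ ?p]) auto
  qed
  moreover have "hat_interp N v 0 = 0"
    using hat_interp_node[of N 0 v] assms by simp
  ultimately show ?thesis by (simp add: S_h_def)
qed

lemma cell_cases:
  assumes "x \<in> {0..1}" "0 < N"
  obtains j where "j < N" "x \<in> {real j / real N..real (Suc j) / real N}"
proof (cases "x = 1")
  case True
  then show ?thesis using assms by (intro that[of "N - 1"]) auto
next
  case False
  define j where "j = nat \<lfloor>real N * x\<rfloor>"
  have j: "real j \<le> real N * x" "real N * x < real j + 1"
    unfolding j_def using assms by (auto simp: of_nat_nat)
  have "real N * x < real N" using assms False by simp
  then have "j < N" using j by linarith
  then show ?thesis using j assms by (intro that[of j]) (auto simp: field_simps)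
qed

lemma S_h_eq_hat_interp:
  assumes "\<phi> \<in> S_h N" "0 < N" "x \<in> {0..1}"
  shows "\<phi> x = hat_interp N (\<lambda>j. \<phi> (real j / real N)) x"
proof -
  obtain j where "j < N" "x \<in> {real j / real N..real (Suc j) / real N}"
    using cell_cases assms by metis
  then show ?thesis using S_h_cell[OF assms(1)] hat_interp_cell by metis
qed

lemma hat_interp_diff: "hat_interp N (\<lambda>j. a j - b j) x = hat_interp N a x - hat_interp N b x"
  by (simp add: hat_interp_def sum_subtractf left_diff_distrib)

lemma continuous_on_hat_interp: "continuous_on A (hat_interp N v)"
  unfolding hat_interp_def by (intro continuous_intros)

text \<open>Stated for functions that are integrable cell by cell, because the spatial derivative of a piecewise
  linear function is not continuous across the nodes.\<close>

lemma set_integral_cells: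
  fixes F :: "real \<Rightarrow> real"
  assumes "0 < N"
    and int: "\<And>j. j < N \<Longrightarrow> set_integrable lebesgue {real j / real N..real (Suc j) / real N} F"
  shows "(LINT x:{0..1}|lebesgue. F x) = (\<Sum>j<N. integral {real j / real N..real (Suc j) / real N} F)"
proof -
  have *: "set_integrable lebesgue {0..real n / real N} F \<and>
      (F has_integral (\<Sum>j<n. integral {real j / real N..real (Suc j) / real N} F)) {0..real n / real N}"
    if "n \<le> N" for n
    using that
  proof (induction n)
    case 0
    have "set_integrable lebesgue {0..0} F" by (intro absolutely_integrable_continuous_real) simp
    then show ?case by (simp add: has_integral_refl)
  next
    case (Suc n)
    have le: "0 \<le> real n / real N" "real n / real N \<le> real (Suc n) / real N"
      by (auto intro: divide_right_mono)
    have "{0..real (Suc n) / real N} = {0..real n / real N} \<union> {real n / real N..real (Suc n) / real N}"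
      by (rule ivl_disj_un_two_touch(4)[symmetric]) (rule le)+
    moreover have i: "set_integrable lebesgue {real n / real N..real (Suc n) / real N} F"
      using Suc.prems by (intro int) auto
    ultimately have "set_integrable lebesgue {0..real (Suc n) / real N} F"
      using Suc by (auto intro: absolutely_integrable_Un)
    moreover have "(F has_integral integral {real n / real N..real (Suc n) / real N} F) {real n / real N..real (Suc n) / real N}"
      using set_lebesgue_integral_eq_integral(1)[OF i] by (rule integrable_integral)
    moreover have "(F has_integral (\<Sum>j<n. integral {real j / real N..real (Suc j) / real N} F))
        {0..real n / real N}"
      using Suc by simp
    ultimately show ?case
      using has_integral_combine[OF le, of F] unfolding sum.lessThan_Suc by blast
  qed
  from *[of N] have int: "set_integrable lebesgue {0..1} F" using assms(1) by simp
  show "(LINT x:{0..1}|lebesgue. F x) = (\<Sum>j<N. integral {real j / real N..real (Suc j) / real N} F)"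
    using *[of N] assms(1) set_lebesgue_integral_eq_integral(2)[OF int] by (simp add: integral_unique)
qed

text \<open>The values at the two end points are left open: there the spatial derivative of a piecewise linear
  function is unspecified.\<close>

lemma cell_product_integral:
  fixes F :: "real \<Rightarrow> real"
  assumes "0 < N"
    and F: "\<And>x. x \<in> {real j / real N<..<real (Suc j) / real N} \<Longrightarrow>
      F x = (p + (q - p) * (real N * x - real j)) * (r + (s - r) * (real N * x - real j))"
  shows "set_integrable lebesgue {real j / real N..real (Suc j) / real N} F"
    and "integral {real j / real N..real (Suc j) / real N} F = (2 * p * r + p * s + q * r + 2 * q * s) / (6 * real N)"
proof -
  let ?a = "real j / real N" and ?b = "real (Suc j) / real N"
  let ?y = "\<lambda>x. real N * x - real j"
  define G where "G x = (p + (q - p) * ?y x) * (r + (s - r) * ?y x)" for x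
  define A where "A x = (p * r * ?y x + (p * (s - r) + (q - p) * r) * (?y x)\<^sup>2 / 2
    + (q - p) * (s - r) * (?y x) ^ 3 / 3) / real N" for x
  have neg: "negligible {?a, ?b}" by simp
  have FG: "F x = G x" if "x \<in> {?a..?b} - {?a, ?b}" for x
    using F[of x] that by (auto simp: G_def)
  have "set_integrable lebesgue {?a..?b} G"
    unfolding G_def by (intro absolutely_integrable_continuous_real continuous_intros)
  then show "set_integrable lebesgue {?a..?b} F"
    by (rule absolutely_integrable_spike[OF _ neg FG])
  have "(G has_integral (A ?b - A ?a)) {?a..?b}"
  proof (rule fundamental_theorem_of_calculus)
    show "?a \<le> ?b" by (intro divide_right_mono) auto
    fix x assume "x \<in> {?a..?b}"
    have "DERIV A x :> G x"
      unfolding A_def G_def using assms(1)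
      by (auto intro!: derivative_eq_intros simp: field_simps power2_eq_square)
    then show "(A has_vector_derivative G x) (at x within {?a..?b})"
      using has_field_derivative_at_within has_real_derivative_iff_has_vector_derivative by blast
  qed
  moreover have "A ?b - A ?a = (2 * p * r + p * s + q * r + 2 * q * s) / (6 * real N)"
    using assms(1) by (simp add: A_def field_simps)
  ultimately have "integral {?a..?b} G = (2 * p * r + p * s + q * r + 2 * q * s) / (6 * real N)"
    by (simp add: integral_unique)
  moreover have "integral {?a..?b} F = integral {?a..?b} G"
    by (rule integral_spike[OF neg]) (use FG in auto)
  ultimately show "integral {?a..?b} F = (2 * p * r + p * s + q * r + 2 * q * s) / (6 * real N)" by simp
qed

text \<open>The factors may be discontinuous at the nodes: \<open>p j\<close> and \<open>q j\<close> are the one-sided limits of \<open>f\<close> at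
  the ends of the cell \<open>j\<close>. This covers the spatial derivative, for which \<open>p j = q j\<close>.\<close>

lemma L2_inner_cellwise_affine:
  assumes "0 < N"
    and f: "\<And>j x. j < N \<Longrightarrow> x \<in> {real j / real N<..<real (Suc j) / real N} \<Longrightarrow> f x = p j + (q j - p j) * (real N * x - real j)"
    and g: "\<And>j x. j < N \<Longrightarrow> x \<in> {real j / real N<..<real (Suc j) / real N} \<Longrightarrow> g x = r j + (s j - r j) * (real N * x - real j)"
  shows "L2_inner f g = (\<Sum>j<N. (2 * p j * r j + p j * s j + q j * r j + 2 * q j * s j) / (6 * real N))"
proof -
  have *: "f x * g x = (p j + (q j - p j) * (real N * x - real j)) * (r j + (s j - r j) * (real N * x - real j))"
    if "j < N" "x \<in> {real j / real N<..<real (Suc j) / real N}" for j x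
    using f[OF that] g[OF that] by simp
  note cell = cell_product_integral[OF assms(1) *]
  show ?thesis
    unfolding L2_inner_def using set_integral_cells[OF assms(1) cell(1)] cell(2) by simp
qed

text \<open>The \<open>L\<^sup>2\<close> inner product of two piecewise linear functions in terms of their nodal values.\<close>

definition mass_form :: "nat \<Rightarrow> (nat \<Rightarrow> real) \<Rightarrow> (nat \<Rightarrow> real) \<Rightarrow> real" where
  "mass_form N u v = (\<Sum>j<N. (2 * u j * v j + u j * v (Suc j) + u (Suc j) * v j + 2 * u (Suc j) * v (Suc j)) / (6 * real N))"

text \<open>The \<open>L\<^sup>2\<close> inner product of the derivative of one piecewise linear function with another one, in
  terms of their nodal values.\<close>

definition transport_form :: "nat \<Rightarrow> (nat \<Rightarrow> real) \<Rightarrow> (nat \<Rightarrow> real) \<Rightarrow> real" where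
  "transport_form N u v = (\<Sum>j<N. (u (Suc j) - u j) * (v j + v (Suc j)) / 2)"

text \<open>The discrete counterpart of \<open>\<integral> u\<^sub>x u = u(1)\<^sup>2 / 2\<close>; it is the outflow term that makes the scheme
  stable.\<close>

lemma transport_form_self:
  assumes "e 0 = 0"
  shows "transport_form N e e = (e N)\<^sup>2 / 2"
proof -
  have "transport_form N e e = (\<Sum>j<N. (e (Suc j))\<^sup>2 / 2 - (e j)\<^sup>2 / 2)"
    unfolding transport_form_def by (intro sum.cong refl) (simp add: power2_eq_square field_simps)
  also have "\<dots> = (e N)\<^sup>2 / 2 - (e 0)\<^sup>2 / 2" by (rule sum_lessThan_telescope)
  finally show ?thesis using assms by simp
qed

text \<open>On each cell \<open>2 (a\<^sup>2 + a b + b\<^sup>2) = a\<^sup>2 + b\<^sup>2 + (a + b)\<^sup>2\<close>.\<close>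

lemma mass_form_lower_bound:
  "(\<Sum>j<N. (e j)\<^sup>2) / (6 * real N) \<le> mass_form N e e"
  unfolding mass_form_def sum_divide_distrib
proof (intro sum_mono divide_right_mono)
  fix j
  have "2 * e j * e j + e j * e (Suc j) + e (Suc j) * e j + 2 * e (Suc j) * e (Suc j)
      = (e j)\<^sup>2 + (e (Suc j))\<^sup>2 + (e j + e (Suc j))\<^sup>2"
    by (simp add: power2_eq_square algebra_simps)
  then show "(e j)\<^sup>2 \<le> 2 * e j * e j + e j * e (Suc j) + e (Suc j) * e j + 2 * e (Suc j) * e (Suc j)"
    by simp
qed auto

lemma mass_form_diff: "mass_form N (\<lambda>j. a j - b j) v = mass_form N a v - mass_form N b v"
  unfolding mass_form_def sum_subtractf[symmetric] diff_divide_distrib[symmetric]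
  by (intro sum.cong refl arg_cong2[where f = "(/)"]) (simp add: algebra_simps)

lemma transport_form_diff: "transport_form N (\<lambda>j. a j - b j) v = transport_form N a v - transport_form N b v"
  unfolding transport_form_def sum_subtractf[symmetric] diff_divide_distrib[symmetric]
  by (intro sum.cong refl arg_cong2[where f = "(/)"]) (simp add: algebra_simps)

lemma DERIV_mass_form:
  assumes "0 < N" "\<And>j. j \<le> N \<Longrightarrow> ((\<lambda>s. e s j) has_real_derivative e' j) (at t within S)"
  shows "((\<lambda>s. mass_form N (e s) (e s)) has_real_derivative 2 * mass_form N e' (e t)) (at t within S)"
proof -
  have "((\<lambda>s. mass_form N (e s) (e s)) has_real_derivative
    (\<Sum>j<N. 2 * ((2 * e' j * e t j + e' j * e t (Suc j) + e' (Suc j) * e t j + 2 * e' (Suc j) * e t (Suc j)) / (6 * real N))))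
    (at t within S)"
    unfolding mass_form_def
  proof (rule DERIV_sum)
    fix j assume "j \<in> {..<N}"
    then have d: "((\<lambda>s. e s j) has_real_derivative e' j) (at t within S)"
      "((\<lambda>s. e s (Suc j)) has_real_derivative e' (Suc j)) (at t within S)"
      by (auto intro: assms(2))
    show "((\<lambda>s. (2 * e s j * e s j + e s j * e s (Suc j) + e s (Suc j) * e s j + 2 * e s (Suc j) * e s (Suc j)) / (6 * real N))
      has_real_derivative 2 * ((2 * e' j * e t j + e' j * e t (Suc j) + e' (Suc j) * e t j + 2 * e' (Suc j) * e t (Suc j)) / (6 * real N)))
      (at t within S)"
    proof (rule DERIV_cong[OF DERIV_cdivide])
      show "((\<lambda>s. 2 * e s j * e s j + e s j * e s (Suc j) + e s (Suc j) * e s j + 2 * e s (Suc j) * e s (Suc j))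
        has_real_derivative (2 * e' j * e t j + e' j * (2 * e t j)) + (e' j * e t (Suc j) + e' (Suc j) * e t j)
          + (e' (Suc j) * e t j + e' j * e t (Suc j)) + (2 * e' (Suc j) * e t (Suc j) + e' (Suc j) * (2 * e t (Suc j))))
        (at t within S)"
        by (intro DERIV_add DERIV_mult DERIV_cmult d)
    qed (simp add: add_divide_distrib)
  qed
  then show ?thesis by (simp add: mass_form_def sum_distrib_left)
qed

lemma L2_inner_hat_interp:
  assumes "0 < N"
  shows "L2_inner (hat_interp N u) (hat_interp N v) = mass_form N u v"
  unfolding mass_form_def
  using hat_interp_cell by (intro L2_inner_cellwise_affine[OF assms]) auto

lemma semidiscrete_solution_DERIV_node:
  assumes N: "0 < N" and sol: "semidiscrete_solution N T f \<eta>\<^sub>h" and t: "t \<in> {0..T}" and j: "j \<le> N"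
  shows "((\<lambda>s. \<eta>\<^sub>h s (real j / real N)) has_real_derivative
    derivative_on {0..T} (\<lambda>s. \<eta>\<^sub>h s (real j / real N)) t) (at t within {0..T})"
proof -
  have "real j / real N \<in> {0..1}" using j N by auto
  then have "(\<lambda>s. \<eta>\<^sub>h s (real j / real N)) differentiable (at t within {0..T})"
    using sol t by (auto simp: semidiscrete_solution_def differentiable_on_def)
  then show ?thesis
    by (simp add: derivative_on_def vector_derivative_works
        has_real_derivative_iff_has_vector_derivative)
qed

text \<open>The test function is the piecewise linear one with nodal values \<open>v\<close>. The time derivative of the
  semidiscrete solution is again affine on each cell, its spatial derivative is constant there.\<close>

lemma semidiscrete_solution_nodal_equation:
  assumes T: "0 < T" and N: "0 < N" and sol: "semidiscrete_solution N T f \<eta>\<^sub>h" and t: "t \<in> {0..T}" and v: "v 0 = 0"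
  shows "mass_form N (\<lambda>j. derivative_on {0..T} (\<lambda>s. \<eta>\<^sub>h s (real j / real N)) t) v
    + transport_form N (\<lambda>j. \<eta>\<^sub>h t (real j / real N)) v = 0"
proof -
  define U' where "U' j = derivative_on {0..T} (\<lambda>s. \<eta>\<^sub>h s (real j / real N)) t" for j
  have S: "\<eta>\<^sub>h s \<in> S_h N" if "s \<in> {0..T}" for s
    using sol that by (simp add: semidiscrete_solution_def)
  have U': "((\<lambda>s. \<eta>\<^sub>h s (real j / real N)) has_real_derivative U' j) (at t within {0..T})" if "j \<le> N" for j
    unfolding U'_def by (rule semidiscrete_solution_DERIV_node[OF N sol t that])
  let ?cell = "\<lambda>j. {real j / real N<..<real (Suc j) / real N}"
  have cell01: "?cell j \<subseteq> {0..1}" if "j < N" for j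
  proof
    fix x assume x: "x \<in> ?cell j"
    have "real (Suc j) / real N \<le> 1" "0 \<le> real j / real N" using that by (auto simp: field_simps)
    then have "0 \<le> x" "x \<le> 1"
      using x unfolding greaterThanLessThan_iff by linarith+
    then show "x \<in> {0..1}" by simp
  qed
  have time: "derivative_on {0..T} (\<lambda>s. \<eta>\<^sub>h s x) t = U' j + (U' (Suc j) - U' j) * (real N * x - real j)"
    if "j < N" "x \<in> ?cell j" for j x
  proof -
    have "((\<lambda>s. \<eta>\<^sub>h s (real j / real N) + (\<eta>\<^sub>h s (real (Suc j) / real N) - \<eta>\<^sub>h s (real j / real N)) * (real N * x - real j))
      has_real_derivative U' j + (U' (Suc j) - U' j) * (real N * x - real j)) (at t within {0..T})"
      by (intro DERIV_add DERIV_diff DERIV_cmult_right U') (use that in auto)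
    then have "((\<lambda>s. \<eta>\<^sub>h s x) has_real_derivative U' j + (U' (Suc j) - U' j) * (real N * x - real j)) (at t within {0..T})"
      by (rule has_field_derivative_transform_within[OF _ zero_less_one t])
        (use S_h_cell[OF S \<open>j < N\<close>, of _ x] that in auto)
    then show ?thesis
      unfolding derivative_on_def using T t
      by (intro vector_derivative_within_closed_interval)
        (simp_all add: has_real_derivative_iff_has_vector_derivative)
  qed
  define c where "c j = real N * (\<eta>\<^sub>h t (real (Suc j) / real N) - \<eta>\<^sub>h t (real j / real N))" for j
  have space: "derivative_on {0..1} (\<eta>\<^sub>h t) x = c j + (c j - c j) * (real N * x - real j)"
    if "j < N" "x \<in> ?cell j" for j x
  proof -
    have x: "x \<in> {0..1}" using cell01 that by blast
    have "DERIV (\<lambda>x. \<eta>\<^sub>h t (real j / real N) + (\<eta>\<^sub>h t (real (Suc j) / real N) - \<eta>\<^sub>h t (real j / real N)) * (real N * x - real j)) x :> c j"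
      by (auto intro!: derivative_eq_intros simp: c_def)
    then have "DERIV (\<eta>\<^sub>h t) x :> c j"
    proof (rule has_field_derivative_transform_within_open[of _ _ _ "?cell j"])
      show "\<eta>\<^sub>h t (real j / real N) + (\<eta>\<^sub>h t (real (Suc j) / real N) - \<eta>\<^sub>h t (real j / real N)) * (real N * y - real j) = \<eta>\<^sub>h t y"
        if "y \<in> ?cell j" for y
        by (rule S_h_cell[OF S[OF t] \<open>j < N\<close>, symmetric])
          (use that in simp)
    qed (use that in simp_all)
    then have "(\<eta>\<^sub>h t has_vector_derivative c j) (at x within {0..1})"
      using has_field_derivative_at_within has_real_derivative_iff_has_vector_derivative by blast
    then show ?thesis
      unfolding derivative_on_def using x
      by (simp add: vector_derivative_within_closed_interval)
  qed
  have v_cell: "hat_interp N v x = v j + (v (Suc j) - v j) * (real N * x - real j)"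
    if "j < N" "x \<in> ?cell j" for j x
    using hat_interp_cell[OF that(1)] that(2) by auto
  have "L2_inner (\<lambda>x. derivative_on {0..T} (\<lambda>s. \<eta>\<^sub>h s x) t) (hat_interp N v) = mass_form N U' v"
    unfolding mass_form_def by (rule L2_inner_cellwise_affine[OF N time v_cell])
  moreover have "L2_inner (derivative_on {0..1} (\<eta>\<^sub>h t)) (hat_interp N v)
      = transport_form N (\<lambda>j. \<eta>\<^sub>h t (real j / real N)) v"
  proof -
    have "(2 * c j * v j + c j * v (Suc j) + c j * v j + 2 * c j * v (Suc j)) / (6 * real N)
        = (\<eta>\<^sub>h t (real (Suc j) / real N) - \<eta>\<^sub>h t (real j / real N)) * (v j + v (Suc j)) / 2" for j
    proof -
      define \<delta> where "\<delta> = \<eta>\<^sub>h t (real (Suc j) / real N) - \<eta>\<^sub>h t (real j / real N)"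
      have "c j = real N * \<delta>" by (simp only: c_def \<delta>_def)
      then show ?thesis unfolding \<delta>_def[symmetric] using N by (simp add: field_simps)
    qed
    then show ?thesis
      using L2_inner_cellwise_affine[OF N space v_cell] unfolding transport_form_def by (simp only:)
  qed
  moreover have "L2_inner (\<lambda>x. derivative_on {0..T} (\<lambda>s. \<eta>\<^sub>h s x) t) (hat_interp N v)
      + L2_inner (derivative_on {0..1} (\<eta>\<^sub>h t)) (hat_interp N v) = 0"
    using sol t hat_interp_in_S_h[of N v, OF N v] unfolding semidiscrete_solution_def by blast
  ultimately show ?thesis by (simp add: U'_def[abs_def])
qed

section \<open>Consistency of the scheme\<close>

lemma DERIV_increment_bound:
  fixes g g' :: "real \<Rightarrow> real"
  assumes "\<And>z. DERIV g z :> g' z"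
    and "\<And>z. min x y \<le> z \<Longrightarrow> z \<le> max x y \<Longrightarrow> \<bar>g' z\<bar> \<le> B"
  shows "\<bar>g y - g x\<bar> \<le> B * \<bar>y - x\<bar>"
proof -
  have "norm (g y - g x) \<le> B * norm (y - x)"
    by (rule field_differentiable_bound[where S = "{min x y..max x y}" and f' = g'])
      (use assms in \<open>auto intro: has_field_derivative_at_within[OF assms(1)]\<close>)
  then show ?thesis by simp
qed

context wave_profile
begin

lemma deriv_w0: "DERIV (w 0) y :> w 1 y" and deriv_w1: "DERIV (w 1) y :> w 2 y"
  using deriv_w[of 0 y] deriv_w[of 1 y] by (simp_all add: numeral_2_eq_2)

lemma w1_taylor:
  assumes "x \<le> 1" "y \<le> 1"
  shows "\<bar>w 1 y - w 1 x - (y - x) * w 2 x\<bar> \<le> K * \<bar>y - x\<bar>\<^sup>2"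
proof -
  have "\<bar>(w 1 y - y * w 2 x) - (w 1 x - x * w 2 x)\<bar> \<le> (K * \<bar>y - x\<bar>) * \<bar>y - x\<bar>"
  proof (rule DERIV_increment_bound)
    show "DERIV (\<lambda>z. w 1 z - z * w 2 x) z :> w 2 z - w 2 x" for z
      by (auto intro!: derivative_eq_intros deriv_w1 simp del: One_nat_def)
    fix z assume z: "min x y \<le> z" "z \<le> max x y"
    have "\<bar>w 2 z - w 2 x\<bar> \<le> K * \<bar>z - x\<bar>" using z assms by (intro w2_lipschitz) auto
    also have "\<dots> \<le> K * \<bar>y - x\<bar>" using z K_nonneg by (intro mult_left_mono) auto
    finally show "\<bar>w 2 z - w 2 x\<bar> \<le> K * \<bar>y - x\<bar>" .
  qed
  then show ?thesis by (simp add: algebra_simps power2_eq_square)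
qed

lemma w0_taylor:
  assumes "x \<le> 1" "y \<le> 1"
  shows "\<bar>w 0 y - w 0 x - (y - x) * w 1 x - (y - x)\<^sup>2 / 2 * w 2 x\<bar> \<le> K * \<bar>y - x\<bar> ^ 3"
proof -
  let ?g = "\<lambda>z. w 0 z - z * w 1 x - (z - x)\<^sup>2 / 2 * w 2 x"
  have "\<bar>?g y - ?g x\<bar> \<le> (K * \<bar>y - x\<bar>\<^sup>2) * \<bar>y - x\<bar>"
  proof (rule DERIV_increment_bound)
    show "DERIV ?g z :> w 1 z - w 1 x - (z - x) * w 2 x" for z
      by (auto intro!: derivative_eq_intros deriv_w0 simp del: One_nat_def)
    fix z assume z: "min x y \<le> z" "z \<le> max x y"
    have "\<bar>w 1 z - w 1 x - (z - x) * w 2 x\<bar> \<le> K * \<bar>z - x\<bar>\<^sup>2" using z assms by (intro w1_taylor) auto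
    also have "\<dots> \<le> K * \<bar>y - x\<bar>\<^sup>2" using z K_nonneg by (intro mult_left_mono power_mono) auto
    finally show "\<bar>w 1 z - w 1 x - (z - x) * w 2 x\<bar> \<le> K * \<bar>y - x\<bar>\<^sup>2" .
  qed
  moreover have "?g y - ?g x = w 0 y - w 0 x - (y - x) * w 1 x - (y - x)\<^sup>2 / 2 * w 2 x"
    by (simp add: algebra_simps)
  ultimately show ?thesis by (simp add: power3_eq_cube power2_eq_square mult.assoc)
qed

lemma w1_increment:
  assumes "x \<le> 1" "y \<le> 1"
  shows "\<bar>w 1 y - w 1 x\<bar> \<le> K * \<bar>y - x\<bar>"
  by (rule DERIV_increment_bound[OF deriv_w1]) (use assms in \<open>auto intro!: w_bound\<close>)

lemma w0_tangent:
  assumes "x \<le> 1" "y \<le> 1"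
  shows "\<bar>w 0 y - w 0 x - (y - x) * w 1 x\<bar> \<le> K * \<bar>y - x\<bar>\<^sup>2"
proof -
  have "\<bar>(w 0 y - y * w 1 x) - (w 0 x - x * w 1 x)\<bar> \<le> (K * \<bar>y - x\<bar>) * \<bar>y - x\<bar>"
  proof (rule DERIV_increment_bound)
    show "DERIV (\<lambda>z. w 0 z - z * w 1 x) z :> w 1 z - w 1 x" for z
      by (auto intro!: derivative_eq_intros deriv_w0 simp del: One_nat_def)
    fix z assume z: "min x y \<le> z" "z \<le> max x y"
    have "\<bar>w 1 z - w 1 x\<bar> \<le> K * \<bar>z - x\<bar>" using z assms by (intro w1_increment) auto
    also have "\<dots> \<le> K * \<bar>y - x\<bar>" using z K_nonneg by (intro mult_left_mono) auto
    finally show "\<bar>w 1 z - w 1 x\<bar> \<le> K * \<bar>y - x\<bar>" .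
  qed
  then show ?thesis by (simp add: algebra_simps power2_eq_square)
qed

text \<open>This is half the error of Simpson's rule for \<open>\<integral> w 1\<close> over \<open>[y - h, y + h]\<close>. In the
  Taylor expansions about the midpoint the terms with \<open>w 2 y\<close> cancel by symmetry, and only the
  remainders are left. The Lipschitz continuity of \<open>w 2\<close> suffices, so that the jump of \<open>w 3\<close> at the
  wave front does no harm.\<close>

lemma simpson_defect:
  assumes h: "0 \<le> h" "y + h \<le> 1"
  shows "\<bar>h / 6 * (w 1 (y - h) + 4 * w 1 y + w 1 (y + h)) - (w 0 (y + h) - w 0 (y - h)) / 2\<bar> \<le> 2 * (K * h ^ 3)"
proof -
  define s\<^sub>1 s\<^sub>2 where "s\<^sub>1 = w 1 (y + h) - w 1 y - h * w 2 y" and "s\<^sub>2 = w 1 (y - h) - w 1 y + h * w 2 y"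
  define r\<^sub>1 r\<^sub>2 where "r\<^sub>1 = w 0 (y + h) - w 0 y - h * w 1 y - h\<^sup>2 / 2 * w 2 y"
    and "r\<^sub>2 = w 0 (y - h) - w 0 y + h * w 1 y - h\<^sup>2 / 2 * w 2 y"
  have s: "\<bar>s\<^sub>1\<bar> \<le> K * h\<^sup>2" "\<bar>s\<^sub>2\<bar> \<le> K * h\<^sup>2"
    using w1_taylor[of y "y + h"] w1_taylor[of y "y - h"] h by (simp_all add: s\<^sub>1_def s\<^sub>2_def)
  have r: "\<bar>r\<^sub>1\<bar> \<le> K * h ^ 3" "\<bar>r\<^sub>2\<bar> \<le> K * h ^ 3"
    using w0_taylor[of y "y + h"] w0_taylor[of y "y - h"] h by (simp_all add: r\<^sub>1_def r\<^sub>2_def)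
  have "\<bar>s\<^sub>1 + s\<^sub>2\<bar> \<le> 2 * (K * h\<^sup>2)" using s by linarith
  then have "h / 6 * \<bar>s\<^sub>1 + s\<^sub>2\<bar> \<le> h / 6 * (2 * (K * h\<^sup>2))"
    using h by (intro mult_left_mono) auto
  then have "\<bar>h / 6 * (s\<^sub>1 + s\<^sub>2)\<bar> \<le> h / 6 * (2 * (K * h\<^sup>2))"
    using h by (simp add: abs_mult)
  also have "\<dots> = K * h ^ 3 / 3" by (simp add: power2_eq_square power3_eq_cube)
  finally have "\<bar>h / 6 * (s\<^sub>1 + s\<^sub>2)\<bar> \<le> K * h ^ 3 / 3" .
  moreover have "0 \<le> K * h ^ 3" using K_nonneg h by simp
  moreover have "\<bar>q - r\<^sub>1 / 2 + r\<^sub>2 / 2\<bar> \<le> 2 * B" if "\<bar>q\<bar> \<le> B / 3" "0 \<le> B" "\<bar>r\<^sub>1\<bar> \<le> B" "\<bar>r\<^sub>2\<bar> \<le> B"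
    for q B :: real
    using that by linarith
  ultimately have "\<bar>h / 6 * (s\<^sub>1 + s\<^sub>2) - r\<^sub>1 / 2 + r\<^sub>2 / 2\<bar> \<le> 2 * (K * h ^ 3)"
    using r by blast
  moreover have "h / 6 * (w 1 (y - h) + 4 * w 1 y + w 1 (y + h)) - (w 0 (y + h) - w 0 (y - h)) / 2
      = h / 6 * (s\<^sub>1 + s\<^sub>2) - r\<^sub>1 / 2 + r\<^sub>2 / 2"
    unfolding s\<^sub>1_def s\<^sub>2_def r\<^sub>1_def r\<^sub>2_def by (simp add: field_simps)
  ultimately show ?thesis by (simp only:)
qed

text \<open>At the last node there is no symmetry and one order of \<open>h\<close> is lost.\<close>

lemma outflow_defect:
  assumes h: "0 \<le> h" "y \<le> 1"
  shows "\<bar>h / 6 * (w 1 (y - h) + 2 * w 1 y) - (w 0 y - w 0 (y - h)) / 2\<bar> \<le> K * h\<^sup>2"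
proof -
  define \<alpha> where "\<alpha> = w 1 (y - h) - w 1 y"
  define r where "r = w 0 (y - h) - w 0 y + h * w 1 y"
  have "\<bar>\<alpha>\<bar> \<le> K * h" using w1_increment[of y "y - h"] h by (simp add: \<alpha>_def)
  then have "h / 6 * \<bar>\<alpha>\<bar> \<le> h / 6 * (K * h)" using h by (intro mult_left_mono) auto
  then have "\<bar>h / 6 * \<alpha>\<bar> \<le> K * h\<^sup>2 / 6" using h by (simp add: abs_mult power2_eq_square mult_ac)
  moreover have "\<bar>r\<bar> \<le> K * h\<^sup>2" using w0_tangent[of y "y - h"] h by (simp add: r_def)
  moreover have "0 \<le> K * h\<^sup>2" using K_nonneg by simp
  moreover have "h / 6 * (w 1 (y - h) + 2 * w 1 y) - (w 0 y - w 0 (y - h)) / 2 = h / 6 * \<alpha> + r / 2"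
    unfolding \<alpha>_def r_def by (simp add: field_simps)
  ultimately show ?thesis by linarith
qed

lemma linear_interpolation_error:
  assumes "0 < h" "a + h \<le> 1" "x \<in> {a..a + h}"
  shows "\<bar>w 0 x - (w 0 a + (w 0 (a + h) - w 0 a) * ((x - a) / h))\<bar> \<le> 2 * (K * h\<^sup>2)"
proof -
  define r\<^sub>1 where "r\<^sub>1 = w 0 x - w 0 a - (x - a) * w 1 a"
  define r\<^sub>2 where "r\<^sub>2 = w 0 (a + h) - w 0 a - h * w 1 a"
  have "\<bar>r\<^sub>1\<bar> \<le> K * \<bar>x - a\<bar>\<^sup>2" using w0_tangent[of a x] assms by (simp add: r\<^sub>1_def)
  also have "\<dots> \<le> K * h\<^sup>2" using assms K_nonneg by (intro mult_left_mono power_mono) auto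
  finally have 1: "\<bar>r\<^sub>1\<bar> \<le> K * h\<^sup>2" .
  have "\<bar>r\<^sub>2\<bar> \<le> K * h\<^sup>2" using w0_tangent[of a "a + h"] assms by (simp add: r\<^sub>2_def)
  moreover have "\<bar>(x - a) / h\<bar> \<le> 1" using assms by (auto simp: abs_le_iff field_simps)
  ultimately have "\<bar>r\<^sub>2 * ((x - a) / h)\<bar> \<le> K * h\<^sup>2 * 1"
    unfolding abs_mult using K_nonneg by (intro mult_mono) auto
  with 1 have "\<bar>r\<^sub>1\<bar> + \<bar>r\<^sub>2 * ((x - a) / h)\<bar> \<le> K * h\<^sup>2 + K * h\<^sup>2 * 1" by (rule add_mono)
  with abs_triangle_ineq4 have "\<bar>r\<^sub>1 - r\<^sub>2 * ((x - a) / h)\<bar> \<le> K * h\<^sup>2 + K * h\<^sup>2 * 1"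
    by (rule order_trans)
  then have "\<bar>r\<^sub>1 - r\<^sub>2 * ((x - a) / h)\<bar> \<le> 2 * (K * h\<^sup>2)" by simp
  moreover have "w 0 x - (w 0 a + (w 0 (a + h) - w 0 a) * ((x - a) / h)) = r\<^sub>1 - r\<^sub>2 * ((x - a) / h)"
    unfolding r\<^sub>1_def r\<^sub>2_def using assms(1) by (simp add: field_simps)
  ultimately show ?thesis by (simp only:)
qed

lemma hat_interp_error:
  assumes "0 < N" "0 \<le> t" "x \<in> {0..1}"
  shows "\<bar>w 0 (x - t) - hat_interp N (\<lambda>j. w 0 (real j / real N - t)) x\<bar> \<le> 2 * (K * (1 / real N)\<^sup>2)"
proof -
  obtain j where j: "j < N" "x \<in> {real j / real N..real (Suc j) / real N}"
    using cell_cases assms by metis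
  let ?a = "real j / real N - t" and ?h = "1 / real N"
  have S: "real (Suc j) / real N - t = ?a + ?h" by (simp add: add_divide_distrib)
  have "real (Suc j) / real N \<le> 1" using j by simp
  then have "?a + ?h \<le> 1" unfolding S[symmetric] using assms(2) by linarith
  moreover have "x - t \<in> {?a..?a + ?h}" using j(2) unfolding S[symmetric] by simp
  ultimately have "\<bar>w 0 (x - t) - (w 0 ?a + (w 0 (?a + ?h) - w 0 ?a) * ((x - t - ?a) / ?h))\<bar> \<le> 2 * (K * ?h\<^sup>2)"
    using assms(1) by (intro linear_interpolation_error) auto
  moreover have "(x - t - ?a) / ?h = real N * x - real j" using assms(1) by (simp add: field_simps)
  ultimately show ?thesis
    unfolding hat_interp_cell[OF j] S by simp
qed

end

text \<open>Summation by parts: each interior node collects a contribution from the cell on its right and one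
  from the cell on its left.\<close>

lemma sum_cells_by_nodes:
  fixes \<alpha> \<beta> e :: "nat \<Rightarrow> real"
  assumes "e 0 = 0"
  shows "(\<Sum>j<Suc m. \<alpha> j * e j + \<beta> j * e (Suc j)) = (\<Sum>i<m. (\<alpha> (Suc i) + \<beta> i) * e (Suc i)) + \<beta> m * e (Suc m)"
proof -
  have "(\<Sum>j<Suc m. \<alpha> j * e j) = (\<Sum>i<m. \<alpha> (Suc i) * e (Suc i))"
    unfolding sum.lessThan_Suc_shift using assms by simp
  then show ?thesis by (simp add: sum.distrib algebra_simps)
qed

text \<open>Each cell contributes \<open>\<alpha> j * e j + \<beta> j * e (Suc j)\<close> with coefficients that are only of order \<open>h\<^sup>2\<close>.
  Collected by nodes, the coefficient \<open>\<alpha> (Suc i) + \<beta> i\<close> is the defect in Simpson's rule, which is one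
  order smaller; this is where the uniformity of the mesh enters.\<close>

lemma (in wave_profile) consistency:
  fixes e :: "nat \<Rightarrow> real"
  assumes "0 < N" "0 \<le> t" "e 0 = 0"
  defines "u \<equiv> \<lambda>j. w 0 (real j / real N - t)" and "u' \<equiv> \<lambda>j. - w 1 (real j / real N - t)"
    and "h \<equiv> 1 / real N"
  shows "\<bar>mass_form N u' e + transport_form N u e\<bar> \<le> (\<Sum>j<N. 2 * (K * h ^ 3) * \<bar>e j\<bar>) + K * h\<^sup>2 * \<bar>e N\<bar>"
proof -
  obtain m where m: "N = Suc m" using assms(1) by (cases N) auto
  have h: "0 < h" using assms(1) by (simp add: h_def)
  define \<alpha> where "\<alpha> j = h / 6 * (2 * u' j + u' (Suc j)) + (u (Suc j) - u j) / 2" for j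
  define \<beta> where "\<beta> j = h / 6 * (u' j + 2 * u' (Suc j)) + (u (Suc j) - u j) / 2" for j
  have node: "real (Suc j) / real N - t = (real j / real N - t) + h" for j
    by (simp add: h_def add_divide_distrib)
  have le1: "real j / real N - t \<le> 1" if "j \<le> N" for j
  proof -
    have "real j / real N \<le> 1" using that assms(1) by simp
    then show ?thesis using assms(2) by linarith
  qed
  have cell: "(2 * a * c + a * d + b * c + 2 * b * d) / (6 * real N) + (p - q) * (c + d) / 2
      = (h / 6 * (2 * a + b) + (p - q) / 2) * c + (h / 6 * (a + 2 * b) + (p - q) / 2) * d"
    for a b c d p q :: real
    using assms(1) by (simp add: h_def field_simps)
  have "mass_form N u' e + transport_form N u e = (\<Sum>j<Suc m. \<alpha> j * e j + \<beta> j * e (Suc j))"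
    unfolding mass_form_def transport_form_def sum.distrib[symmetric] m[symmetric] \<alpha>_def \<beta>_def
    by (intro sum.cong refl cell)
  also have "\<dots> = (\<Sum>i<m. (\<alpha> (Suc i) + \<beta> i) * e (Suc i)) + \<beta> m * e (Suc m)"
    by (rule sum_cells_by_nodes[of e, OF assms(3)])
  finally have eq: "mass_form N u' e + transport_form N u e = \<dots>" .
  have inner: "\<bar>\<alpha> (Suc i) + \<beta> i\<bar> \<le> 2 * (K * h ^ 3)" if "i < m" for i
  proof -
    define y where "y = real (Suc i) / real N - t"
    have prev: "real i / real N - t = y - h" and nxt: "real (Suc (Suc i)) / real N - t = y + h"
      using node[of i] node[of "Suc i"] by (simp_all only: y_def)
    have "\<alpha> (Suc i) + \<beta> i = - (h / 6 * (w 1 (y - h) + 4 * w 1 y + w 1 (y + h)) - (w 0 (y + h) - w 0 (y - h)) / 2)"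
      unfolding \<alpha>_def \<beta>_def u_def u'_def prev nxt y_def[symmetric] by (simp add: field_simps)
    moreover have "y + h \<le> 1" using le1[of "Suc (Suc i)"] that m nxt by simp
    ultimately show ?thesis using simpson_defect[of h y] h by simp
  qed
  have last: "\<bar>\<beta> m\<bar> \<le> K * h\<^sup>2"
  proof -
    define y where "y = real (Suc m) / real N - t"
    have prev: "real m / real N - t = y - h"
      using node[of m] by (simp only: y_def)
    have "\<beta> m = - (h / 6 * (w 1 (y - h) + 2 * w 1 y) - (w 0 y - w 0 (y - h)) / 2)"
      unfolding \<beta>_def u_def u'_def prev y_def[symmetric] by (simp add: field_simps)
    moreover have "y \<le> 1" using le1[of "Suc m"] m by (simp add: y_def)
    ultimately show ?thesis using outflow_defect[of h y] h by simp
  qed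
  have "\<bar>\<Sum>i<m. (\<alpha> (Suc i) + \<beta> i) * e (Suc i)\<bar> \<le> (\<Sum>i<m. 2 * (K * h ^ 3) * \<bar>e (Suc i)\<bar>)"
    using inner by (intro sum_norm_le[where 'a = real, simplified])
      (auto simp: abs_mult intro!: mult_right_mono)
  also have "\<dots> = (\<Sum>j<N. 2 * (K * h ^ 3) * \<bar>e j\<bar>)"
    unfolding m sum.lessThan_Suc_shift using assms(3) by simp
  finally have "\<bar>\<Sum>i<m. (\<alpha> (Suc i) + \<beta> i) * e (Suc i)\<bar> \<le> (\<Sum>j<N. 2 * (K * h ^ 3) * \<bar>e j\<bar>)" .
  moreover have "\<bar>\<beta> m * e (Suc m)\<bar> \<le> K * h\<^sup>2 * \<bar>e N\<bar>"
    unfolding abs_mult m using last by (intro mult_right_mono) auto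
  ultimately show ?thesis unfolding eq by linarith
qed

section \<open>Energy estimate\<close>

text \<open>The function \<open>exp (- B s) (E s + A / B)\<close> is nonincreasing.\<close>

lemma gronwall_le:
  fixes E E' :: "real \<Rightarrow> real"
  assumes deriv: "\<And>s. s \<in> {0..T} \<Longrightarrow> (E has_real_derivative E' s) (at s within {0..T})"
    and le: "\<And>s. s \<in> {0..T} \<Longrightarrow> E' s \<le> A + B * E s" and A: "0 \<le> A" and B: "0 < B" and t: "t \<in> {0..T}"
  shows "E t \<le> exp (B * t) * (E 0 + A / B)"
proof -
  define g where "g s = exp (- (B * s)) * (E s + A / B)" for s
  have g: "(g has_real_derivative exp (- (B * s)) * (E' s - (A + B * E s))) (at s within {0..T})"
    if "s \<in> {0..T}" for s
    unfolding g_def using deriv[OF that] B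
    by (auto intro!: derivative_eq_intros simp: field_simps)
  have "g t \<le> g 0"
  proof (rule DERIV_nonpos_imp_decreasing_open[where f = g])
    show "0 \<le> t" using t by simp
    show "\<exists>y. DERIV g s :> y \<and> y \<le> 0" if "0 < s" "s < t" for s
    proof (intro exI conjI)
      have "s \<in> {0<..<T}" using that t by auto
      then have "(g has_real_derivative exp (- (B * s)) * (E' s - (A + B * E s))) (at s within {0<..<T})"
        using g[of s] by (auto intro: has_field_derivative_subset)
      then show "DERIV g s :> exp (- (B * s)) * (E' s - (A + B * E s))"
        using at_within_open[OF \<open>s \<in> {0<..<T}\<close> open_greaterThanLessThan] by metis
      show "exp (- (B * s)) * (E' s - (A + B * E s)) \<le> 0"
        using le[of s] that t by (intro mult_nonneg_nonpos) auto
    qed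
    have "continuous_on {0..T} g" using g by (rule DERIV_continuous_on)
    then show "continuous_on {0..t} g" by (rule continuous_on_subset) (use t in auto)
  qed
  then have "exp (B * t) * g t \<le> exp (B * t) * g 0" by (intro mult_left_mono) auto
  moreover have "exp (B * t) * g t = E t + A / B"
    unfolding g_def by (simp add: mult.assoc[symmetric] exp_add[symmetric])
  moreover have "exp (B * t) * g 0 = exp (B * t) * (E 0 + A / B)" by (simp add: g_def)
  moreover have "0 \<le> A / B" using A B by simp
  ultimately show ?thesis by linarith
qed


text \<open>Young's inequality. The outflow defect is paid for by \<open>- (e N)\<^sup>2\<close>. Each of the \<open>N = 1 / h\<close> interior
  terms contributes at most \<open>4 K\<^sup>2 h\<^sup>5 + h (e j)\<^sup>2\<close>, and \<open>h\<close> times the sum of the squares is at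
  most \<open>6\<close> times the energy.\<close>

lemma energy_rate_bound:
  fixes e :: "nat \<Rightarrow> real"
  assumes "0 < N" "0 \<le> K"
  defines "h \<equiv> 1 / real N"
  shows "- (e N)\<^sup>2 + 2 * ((\<Sum>j<N. 2 * (K * h ^ 3) * \<bar>e j\<bar>) + K * h\<^sup>2 * \<bar>e N\<bar>)
    \<le> 5 * (K\<^sup>2 * h ^ 4) + 6 * mass_form N e e"
proof -
  have "0 \<le> (K * h\<^sup>2 - \<bar>e N\<bar>)\<^sup>2" by simp
  then have last: "2 * (K * h\<^sup>2 * \<bar>e N\<bar>) \<le> K\<^sup>2 * h ^ 4 + (e N)\<^sup>2"
    by (simp add: power2_eq_square power4_eq_xxxx algebra_simps)
  have "2 * (2 * (K * h ^ 3) * \<bar>e j\<bar>) \<le> 4 * K\<^sup>2 * h ^ 5 + h * (e j)\<^sup>2" for j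
  proof -
    have "0 \<le> h * (2 * K * h\<^sup>2 - \<bar>e j\<bar>)\<^sup>2" by (simp add: h_def)
    then show ?thesis by (simp add: power2_eq_square eval_nat_numeral algebra_simps)
  qed
  then have "(\<Sum>j<N. 2 * (2 * (K * h ^ 3) * \<bar>e j\<bar>)) \<le> (\<Sum>j<N. 4 * K\<^sup>2 * h ^ 5 + h * (e j)\<^sup>2)"
    by (rule sum_mono)
  also have "\<dots> = real N * (4 * K\<^sup>2 * h ^ 5) + h * (\<Sum>j<N. (e j)\<^sup>2)"
    by (simp add: sum.distrib sum_distrib_left)
  also have "real N * (4 * K\<^sup>2 * h ^ 5) = 4 * (K\<^sup>2 * h ^ 4)"
    using assms(1) by (simp add: h_def eval_nat_numeral)
  also have "h * (\<Sum>j<N. (e j)\<^sup>2) \<le> 6 * mass_form N e e"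
    using mass_form_lower_bound[of e N] assms(1) by (simp add: h_def field_simps)
  finally have "2 * (\<Sum>j<N. 2 * (K * h ^ 3) * \<bar>e j\<bar>) \<le> 4 * (K\<^sup>2 * h ^ 4) + 6 * mass_form N e e"
    by (simp add: sum_distrib_left)
  then show ?thesis using last by (simp add: distrib_left)
qed

lemma L2_inner_mono:
  assumes "continuous_on {0..1} (\<lambda>x. f x * g x)" "continuous_on {0..1} (\<lambda>x. p x * q x)"
    and "\<And>x. x \<in> {0..1} \<Longrightarrow> f x * g x \<le> p x * q x"
  shows "L2_inner f g \<le> L2_inner p q"
  unfolding L2_inner_def using assms
  by (intro set_integral_mono absolutely_integrable_continuous_real) auto

lemma L2_inner_le_const:
  assumes "continuous_on {0..1} f" "\<And>x. x \<in> {0..1} \<Longrightarrow> \<bar>f x\<bar> \<le> b"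
  shows "L2_inner f f \<le> b\<^sup>2"
proof -
  have "L2_inner f f \<le> L2_inner (\<lambda>_. b) (\<lambda>_. b)"
  proof (rule L2_inner_mono)
    fix x :: real assume "x \<in> {0..1}"
    then have "\<bar>f x\<bar> ^ 2 \<le> b\<^sup>2" using assms(2) by (intro power_mono) auto
    then show "f x * f x \<le> b * b" by (simp add: power2_eq_square)
  qed (intro continuous_intros assms)+
  also have "L2_inner (\<lambda>_. b) (\<lambda>_. b) = b\<^sup>2"
    by (simp add: L2_inner_def set_lebesgue_integral_def power2_eq_square)
  finally show ?thesis .
qed

lemma L2_inner_diff_left:
  assumes "continuous_on {0..1} f" "continuous_on {0..1} g"
  shows "L2_inner (\<lambda>x. f x - g x) g = L2_inner f g - L2_inner g g"
  unfolding L2_inner_def left_diff_distrib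
  by (intro set_integral_diff(2) absolutely_integrable_continuous_real continuous_on_mult assms)

lemma L2_inner_diff_le:
  assumes "continuous_on {0..1} f" "continuous_on {0..1} g"
  shows "L2_inner (\<lambda>x. f x - g x) (\<lambda>x. f x - g x) \<le> 2 * L2_inner f f + 2 * L2_inner g g"
proof -
  note int = absolutely_integrable_continuous_real[OF continuous_on_mult]
  have i: "set_integrable lebesgue {0..1} (\<lambda>x. f x * f x)" "set_integrable lebesgue {0..1} (\<lambda>x. g x * g x)"
    using assms by (auto intro: int)
  have "(LINT x:{0..1}|lebesgue. (f x - g x) * (f x - g x)) \<le> (LINT x:{0..1}|lebesgue. 2 * (f x * f x) + 2 * (g x * g x))"
  proof (rule set_integral_mono)
    fix x
    have "0 \<le> (f x + g x)\<^sup>2" by simp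
    then show "(f x - g x) * (f x - g x) \<le> 2 * (f x * f x) + 2 * (g x * g x)"
      by (simp add: power2_eq_square algebra_simps)
  qed (use assms i in \<open>auto intro!: set_integral_add int continuous_on_diff\<close>)
  also have "\<dots> = 2 * L2_inner f f + 2 * L2_inner g g"
    using i by (simp add: set_integral_add(2) L2_inner_def)
  finally show ?thesis by (simp add: L2_inner_def)
qed

lemma L2_inner_young:
  assumes "continuous_on {0..1} f" "continuous_on {0..1} g"
  shows "2 * L2_inner f g \<le> L2_inner f f + L2_inner g g"
proof -
  have i: "set_integrable lebesgue {0..1} (\<lambda>x. f x * f x)" "set_integrable lebesgue {0..1} (\<lambda>x. f x * g x)"
    "set_integrable lebesgue {0..1} (\<lambda>x. g x * g x)"
    using assms by (auto intro: absolutely_integrable_continuous_real continuous_on_mult)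
  have "(LINT x:{0..1}|lebesgue. 2 * (f x * g x)) \<le> (LINT x:{0..1}|lebesgue. f x * f x + g x * g x)"
  proof (rule set_integral_mono)
    fix x
    have "0 \<le> (f x - g x)\<^sup>2" by simp
    then show "2 * (f x * g x) \<le> f x * f x + g x * g x"
      by (simp add: power2_eq_square algebra_simps)
  qed (use i in \<open>auto intro!: set_integral_add\<close>)
  then show ?thesis
    using i by (simp add: set_integral_add(2) L2_inner_def)
qed

text \<open>The error is the interpolation error \<open>r\<close> minus the piecewise linear function with nodal values \<open>e\<close>;
  the energy \<open>mass_form N (e s) (e s)\<close> of the latter is controlled first at time \<open>0\<close> and then by
  Gronwall's inequality. Of the constant, \<open>8\<close> comes from \<open>r\<close> and \<open>10 exp (6 T)\<close> from the energy.\<close>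

lemma (in wave_profile) semidiscrete_error:
  assumes T: "0 < T" and N: "0 < N" and sol: "semidiscrete_solution N T f \<eta>\<^sub>h"
    and f: "\<And>x. x \<in> {0..1} \<Longrightarrow> w 0 x = f x" and t: "t \<in> {0..T}"
  shows "L2_norm (\<lambda>x. w 0 (x - t) - \<eta>\<^sub>h t x) \<le> sqrt (8 + 10 * exp (6 * T)) * (1 / real N)\<^sup>2 * K"
proof -
  define h where "h = 1 / real N"
  define e where "e s j = \<eta>\<^sub>h s (real j / real N) - w 0 (real j / real N - s)" for s j
  define r where "r s x = w 0 (x - s) - hat_interp N (\<lambda>j. w 0 (real j / real N - s)) x" for s x
  have S: "\<eta>\<^sub>h s \<in> S_h N" if "s \<in> {0..T}" for s
    using sol that by (simp add: semidiscrete_solution_def)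
  have e0: "e s 0 = 0" if "s \<in> {0..T}" for s
    using S[OF that] w_nonpos[of 0 "- s"] that by (simp add: e_def S_h_def)
  have split: "w 0 (x - s) - \<eta>\<^sub>h s x = r s x - hat_interp N (e s) x" if "s \<in> {0..T}" "x \<in> {0..1}" for s x
    using S_h_eq_hat_interp[OF S[OF that(1)] N that(2)]
    by (simp add: r_def e_def[abs_def] hat_interp_diff)
  have cont_r: "continuous_on {0..1} (r s)" for s
    unfolding r_def
    by (intro continuous_on_diff continuous_on_hat_interp continuous_on_compose2[OF cont_w[of 0 UNIV]] continuous_intros) auto
  note cont_e = continuous_on_hat_interp[of "{0..1}" N]
  have r_small: "L2_inner (r s) (r s) \<le> 4 * (K\<^sup>2 * h ^ 4)" if "0 \<le> s" for s
  proof -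
    have "L2_inner (r s) (r s) \<le> (2 * (K * h\<^sup>2))\<^sup>2"
      using hat_interp_error[OF N that] by (intro L2_inner_le_const[OF cont_r]) (simp add: r_def h_def)
    then show ?thesis by (simp add: power2_eq_square power4_eq_xxxx mult_ac)
  qed

  \<comment> \<open>The projection error is orthogonal to the piecewise linear part of the difference, so that part is no larger than the interpolation error.\<close>
  have initial: "mass_form N (e 0) (e 0) \<le> 4 * (K\<^sup>2 * h ^ 4)"
  proof -
    let ?\<theta> = "hat_interp N (e 0)"
    have "?\<theta> \<in> S_h N" using e0[of 0] T N by (intro hat_interp_in_S_h) auto
    then have "0 = L2_inner (\<lambda>x. f x - \<eta>\<^sub>h 0 x) ?\<theta>"
      using sol by (simp add: semidiscrete_solution_def is_L2_projection_def)
    also have "\<dots> = L2_inner (\<lambda>x. r 0 x - ?\<theta> x) ?\<theta>"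
      using split[of 0] f T by (intro L2_inner_cong) simp
    also have "\<dots> = L2_inner (r 0) ?\<theta> - L2_inner ?\<theta> ?\<theta>"
      by (rule L2_inner_diff_left[OF cont_r cont_e])
    finally have "L2_inner ?\<theta> ?\<theta> \<le> L2_inner (r 0) (r 0)"
      using L2_inner_young[OF cont_r[of 0] cont_e[of "e 0"]] by linarith
    then show ?thesis using r_small[of 0] by (simp add: L2_inner_hat_interp[OF N])
  qed

  define e' where "e' s j = derivative_on {0..T} (\<lambda>s. \<eta>\<^sub>h s (real j / real N)) s + w 1 (real j / real N - s)" for s j
  have energy: "((\<lambda>s. mass_form N (e s) (e s)) has_real_derivative 2 * mass_form N (e' s) (e s)) (at s within {0..T})"
    if s: "s \<in> {0..T}" for s
  proof (rule DERIV_mass_form[OF N])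
    fix j assume j: "j \<le> N"
    have "((\<lambda>s. w 0 (real j / real N - s)) has_real_derivative - w 1 (real j / real N - s)) (at s within {0..T})"
    proof -
      have "((\<lambda>s. real j / real N - s) has_real_derivative 0 - 1) (at s within {0..T})"
        by (rule DERIV_diff[OF DERIV_const DERIV_ident])
      from DERIV_chain'[OF this deriv_w0]
      show ?thesis by (simp del: One_nat_def)
    qed
    from DERIV_diff[OF semidiscrete_solution_DERIV_node[OF N sol s j] this]
    show "((\<lambda>s. e s j) has_real_derivative e' s j) (at s within {0..T})"
      by (simp add: e_def e'_def del: One_nat_def)
  qed
  have rate: "2 * mass_form N (e' s) (e s) \<le> 5 * (K\<^sup>2 * h ^ 4) + 6 * mass_form N (e s) (e s)"
    if s: "s \<in> {0..T}" for s
  proof -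
    let ?U = "\<lambda>j. \<eta>\<^sub>h s (real j / real N)" and ?U' = "\<lambda>j. derivative_on {0..T} (\<lambda>s. \<eta>\<^sub>h s (real j / real N)) s"
    let ?u = "\<lambda>j. w 0 (real j / real N - s)" and ?u' = "\<lambda>j. - w 1 (real j / real N - s)"
    have "mass_form N (e' s) (e s) = mass_form N ?U' (e s) - mass_form N ?u' (e s)"
      unfolding mass_form_diff[symmetric] by (simp add: e'_def[abs_def])
    moreover have "mass_form N ?U' (e s) + transport_form N ?U (e s) = 0"
      by (rule semidiscrete_solution_nodal_equation[where v = "e s", OF T N sol s e0[OF s]])
    moreover have "transport_form N ?U (e s) - transport_form N ?u (e s) = (e s N)\<^sup>2 / 2"
      unfolding transport_form_diff[symmetric] using transport_form_self[of "e s" N, OF e0[OF s]]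
      by (simp add: e_def[abs_def])
    moreover have "2 * m = - q + 2 * - (b + d)" if "m = a - b" "a + c = 0" "c - d = q / 2"
      for a b c d m q :: real
    proof -
      have "q = 2 * (c - d)" "a = - c" using that(2,3) by simp_all
      then show ?thesis using that(1) by simp
    qed
    ultimately have eq: "2 * mass_form N (e' s) (e s)
        = - (e s N)\<^sup>2 + 2 * - (mass_form N ?u' (e s) + transport_form N ?u (e s))"
      by blast
    have "\<bar>mass_form N ?u' (e s) + transport_form N ?u (e s)\<bar>
        \<le> (\<Sum>j<N. 2 * (K * h ^ 3) * \<bar>e s j\<bar>) + K * h\<^sup>2 * \<bar>e s N\<bar>"
      unfolding h_def using s by (intro consistency N e0) auto
    then have "- (mass_form N ?u' (e s) + transport_form N ?u (e s))
        \<le> (\<Sum>j<N. 2 * (K * h ^ 3) * \<bar>e s j\<bar>) + K * h\<^sup>2 * \<bar>e s N\<bar>"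
      by (rule abs_le_D2)
    then have "2 * - (mass_form N ?u' (e s) + transport_form N ?u (e s))
        \<le> 2 * ((\<Sum>j<N. 2 * (K * h ^ 3) * \<bar>e s j\<bar>) + K * h\<^sup>2 * \<bar>e s N\<bar>)"
      by (rule mult_left_mono) simp
    then have "2 * mass_form N (e' s) (e s) \<le> - (e s N)\<^sup>2
        + 2 * ((\<Sum>j<N. 2 * (K * h ^ 3) * \<bar>e s j\<bar>) + K * h\<^sup>2 * \<bar>e s N\<bar>)"
      unfolding eq by (rule add_left_mono)
    also note energy_rate_bound[OF N K_nonneg, of "e s", folded h_def]
    finally show ?thesis .
  qed
  have "mass_form N (e t) (e t) \<le> exp (6 * t) * (mass_form N (e 0) (e 0) + 5 * (K\<^sup>2 * h ^ 4) / 6)"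
    by (rule gronwall_le[where E = "\<lambda>s. mass_form N (e s) (e s)", OF energy rate _ _ t]) auto
  also have "\<dots> \<le> exp (6 * T) * (5 * (K\<^sup>2 * h ^ 4))"
  proof (rule mult_mono)
    have "0 \<le> K\<^sup>2 * h ^ 4" by simp
    then show "mass_form N (e 0) (e 0) + 5 * (K\<^sup>2 * h ^ 4) / 6 \<le> 5 * (K\<^sup>2 * h ^ 4)"
      using initial by linarith
    have "0 \<le> (\<Sum>j<N. (e 0 j)\<^sup>2) / (6 * real N)" by (intro divide_nonneg_nonneg sum_nonneg) auto
    then show "0 \<le> mass_form N (e 0) (e 0) + 5 * (K\<^sup>2 * h ^ 4) / 6"
      using mass_form_lower_bound[of "e 0" N] by (intro add_nonneg_nonneg) auto
  qed (use t in auto)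
  finally have main: "mass_form N (e t) (e t) \<le> exp (6 * T) * (5 * (K\<^sup>2 * h ^ 4))" .

  have "L2_inner (\<lambda>x. w 0 (x - t) - \<eta>\<^sub>h t x) (\<lambda>x. w 0 (x - t) - \<eta>\<^sub>h t x)
      = L2_inner (\<lambda>x. r t x - hat_interp N (e t) x) (\<lambda>x. r t x - hat_interp N (e t) x)"
    using split[OF t] by (intro L2_inner_cong) simp
  also have "\<dots> \<le> 2 * L2_inner (r t) (r t) + 2 * L2_inner (hat_interp N (e t)) (hat_interp N (e t))"
    by (rule L2_inner_diff_le[OF cont_r cont_e])
  also have "\<dots> \<le> 2 * (4 * (K\<^sup>2 * h ^ 4)) + 2 * (exp (6 * T) * (5 * (K\<^sup>2 * h ^ 4)))"
    using r_small[of t] main t unfolding L2_inner_hat_interp[OF N] by (intro add_mono mult_left_mono) auto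
  also have "\<dots> = (8 + 10 * exp (6 * T)) * (h\<^sup>2 * K)\<^sup>2"
    by (simp add: power2_eq_square power4_eq_xxxx algebra_simps)
  finally have "L2_norm (\<lambda>x. w 0 (x - t) - \<eta>\<^sub>h t x) \<le> sqrt ((8 + 10 * exp (6 * T)) * (h\<^sup>2 * K)\<^sup>2)"
    unfolding L2_norm_def by (rule real_sqrt_le_mono)
  also have "\<dots> = sqrt (8 + 10 * exp (6 * T)) * (h\<^sup>2 * K)"
    using K_nonneg by (simp add: real_sqrt_mult)
  finally show ?thesis by (simp add: h_def mult.assoc)
qed

theorem proposition6p1:
  fixes T :: real
  assumes "T > 0"
  shows "\<exists>C :: real. \<forall>(\<eta>\<^sub>0 :: real \<Rightarrow> real) (\<eta> :: real \<Rightarrow> real \<Rightarrow> real).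
           C_k_on 3 {0..1} \<eta>\<^sub>0 \<longrightarrow>
           \<eta>\<^sub>0 0 = 0 \<longrightarrow>
           derivative_on {0..1} \<eta>\<^sub>0 0 = 0 \<longrightarrow>
           (derivative_on {0..1} ^^ 2) \<eta>\<^sub>0 0 = 0 \<longrightarrow>
           transport_solution T \<eta>\<^sub>0 \<eta> \<longrightarrow>
           (\<forall>(N :: nat) (\<eta>\<^sub>h :: real \<Rightarrow> real \<Rightarrow> real).
              N \<ge> 2 \<longrightarrow>
              semidiscrete_solution N T \<eta>\<^sub>0 \<eta>\<^sub>h \<longrightarrow>
              (\<forall>t\<in>{0..T}. L2_norm (\<lambda>x. \<eta> t x - \<eta>\<^sub>h t x)
                 \<le> C * (1 / real N) ^ 2 * (SUP s\<in>{0..T}. Winf_norm 3 (\<eta> s))))"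
proof (intro exI[of _ "sqrt (8 + 10 * exp (6 * T))"] allI impI ballI)
  fix \<eta>\<^sub>0 \<eta> N \<eta>\<^sub>h t
  assume C3: "C_k_on 3 {0..1} \<eta>\<^sub>0" and zero: "\<eta>\<^sub>0 0 = 0" "derivative_on {0..1} \<eta>\<^sub>0 0 = 0"
      "(derivative_on {0..1} ^^ 2) \<eta>\<^sub>0 0 = 0"
    and sol: "transport_solution T \<eta>\<^sub>0 \<eta>" and N: "(2 :: nat) \<le> N"
    and semi: "semidiscrete_solution N T \<eta>\<^sub>0 \<eta>\<^sub>h" and t: "t \<in> {0..T}"
  obtain w d K where "wave_profile w d K" and w0: "\<And>x. x \<in> {0..1} \<Longrightarrow> w 0 x = \<eta>\<^sub>0 x"
    using wave_profile_exists[OF C3 zero] by metis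
  then interpret wave_profile w d K by simp
  let ?M = "SUP s\<in>{0..T}. Winf_norm 3 (\<eta> s)"
  have eq: "\<eta> s x = w 0 (x - s)" if "s \<in> {0..T}" "x \<in> {0..1}" for s x
    using transport_solution_eq[OF assms sol w0 that] .
  have "K \<le> Winf_norm 3 (\<eta> 0)"
    using eq[of 0] assms by (intro Winf_norm_ge) auto
  also have "\<dots> \<le> ?M"
  proof (rule cSUP_upper)
    show "bdd_above ((\<lambda>s. Winf_norm 3 (\<eta> s)) ` {0..T})"
      using eq by (intro bdd_aboveI2[of _ _ K] Winf_norm_le) auto
  qed (use assms in auto)
  finally have K: "K \<le> ?M" .
  have "L2_norm (\<lambda>x. \<eta> t x - \<eta>\<^sub>h t x) = L2_norm (\<lambda>x. w 0 (x - t) - \<eta>\<^sub>h t x)"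
    unfolding L2_norm_def using eq[OF t] by (intro arg_cong[where f = sqrt] L2_inner_cong) simp
  also have "\<dots> \<le> sqrt (8 + 10 * exp (6 * T)) * (1 / real N)\<^sup>2 * K"
    using N by (intro semidiscrete_error[OF assms _ semi w0 t]) auto
  also have "\<dots> \<le> sqrt (8 + 10 * exp (6 * T)) * (1 / real N)\<^sup>2 * ?M"
    using K by (intro mult_left_mono) (auto intro!: mult_nonneg_nonneg add_nonneg_nonneg)
  finally show "L2_norm (\<lambda>x. \<eta> t x - \<eta>\<^sub>h t x) \<le> sqrt (8 + 10 * exp (6 * T)) * (1 / real N) ^ 2 * ?M" .
qed

end
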